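(* Let $V$ be a complex-analytic Lie group and $v\in V$. Let $E_i=\sum_j f_{ij}\phi_{\xi_{ij}}\in\mathcal S(V)$ be a finite set of elements, let $\gimel\subset V$ be the group generated by all $\xi_{ij}$, and let $\mathcal A\subset\mathcal S(V)$ be the subalgebra generated by $H^0(V,\mathcal O)$ and by all $E_i$; suppose that $\mathcal A$ preserves the vector space $\mathfrak O|_{\gimel\cdot v}$. Denote by $Q(\xi_{ij})$ the monoid generated by all $\xi_{ij}$. Assume that (i) $H^0(V,\mathcal O)$ separates points of $\gimel\cdot v$; (ii) $Q(\xi_{ij})=\gimel$; (iii) every $f_{ij}$ has no zeros at $\gimel\cdot v$. Then the $\mathcal A$-module $M(\{e\},\gimel\cdot v)$ is irreducible.
   Context: $\mathcal O$ and $\mathcal M$ are the sheaves of holomorphic and meromorphic functions on $V$, with germs $\mathcal O_x,\mathcal M_x$; $H^0(V,\mathcal O)$ is the algebra of global holomorphic functions. For $\xi\in V$, $\phi_\xi$ is left translation $x\mapsto\xi x$, acting on germs by $\phi_\xi(f)(x)=f(\xi^{-1}x)$. $\mathcal S(V)$ is the skew-group ring of finite sums $\sum_i f_i\phi_{\xi_i}$ with $f_i$ meromorphic on $V$ and $\xi_i\in V$, with product $f\phi_\xi\circ f'\phi_{\xi'}=f\,\phi_\xi(f')\,\phi_{\xi\xi'}$; it acts on $\bigoplus_{x\in V}\mathcal M_x$ by $f\phi_\xi:\mathcal M_x\to\mathcal M_{\xi x}$, $F\mapsto f\phi_\xi(F)$. In each sum $E_i=\sum_j f_{ij}\phi_{\xi_{ij}}$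 the $\xi_{ij}$ ($i$ fixed) are distinct. $\gimel\cdot v=\{\xi v:\xi\in\gimel\}$ and $\mathfrak O|_{\gimel\cdot v}=\bigoplus_{x\in\gimel\cdot v}\mathcal O_x$. $M(\{e\},\gimel\cdot v)=\bigoplus_{x\in\gimel\cdot v}\mathcal O_x/\mathfrak m_x$, where $\mathfrak m_x$ is the ideal of germs vanishing at $x$, with the $\mathcal A$-action induced from that on $\mathfrak O|_{\gimel\cdot v}$. Equivalently, it is the space of finite linear combinations of points of $\gimel\cdot v$ with $A(x)=\sum_i f_i(\xi_i x)\,\xi_i x$ for $A=\sum_i f_i\phi_{\xi_i}$ (distinct $\xi_i$). *)

theory Defs
  imports
    "HOL-Analysis.Analysis"
    "HOL-Algebra.Product_Groups"
    "HOL-Algebra.Generated_Groups"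
    "HOL-Algebra.Generated_Rings"
    "HOL-Algebra.QuotRing"
begin

section \<open>Complex manifolds and complex Lie groups\<close>

text \<open>
  A manifold is modelled on a complex subspace \<open>model M\<close> of \<^typ>\<open>complex ^ 'n\<close> rather than on
  \<^typ>\<open>complex ^ 'n\<close> itself, so that dimension 0 (discrete groups) is not excluded by
  \<open>CARD('n) \<ge> 1\<close>.  The atlas need not be maximal.  A chart is a pair of a domain and a map, whose
  values outside the domain are irrelevant.
\<close>

record ('v, 'n) cmanifold =
  mtop :: "'v topology"
  model :: "(complex ^ 'n) set"
  charts :: "('v set \<times> ('v \<Rightarrow> complex ^ 'n)) set"

text \<open>Holomorphy on a relatively open subset \<open>S\<close> of the complex vector space \<open>E\<close>:
  complex Frechet differentiability at every point.\<close>

definition cholo_on :: "(complex ^ 'n) set \<Rightarrow> (complex ^ 'n) set \<Rightarrow> (complex ^ 'n \<Rightarrow> complex) \<Rightarrow> bool"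
  where "cholo_on E S f \<longleftrightarrow>
    (\<forall>z\<in>S. \<exists>D. (f has_derivative D) (at z within E) \<and> (\<forall>c w. D (c *s w) = c * D w))"

definition complex_manifold :: "('v, 'n::finite) cmanifold \<Rightarrow> bool"
  where "complex_manifold M \<longleftrightarrow>
    Hausdorff_space (mtop M) \<and>
    vec.subspace (model M) \<and>
    (\<Union>(U, \<phi>)\<in>charts M. U) = topspace (mtop M) \<and>
    (\<forall>(U, \<phi>)\<in>charts M.
        openin (mtop M) U \<and>
        openin (top_of_set (model M)) (\<phi> ` U) \<and>
        homeomorphic_map (subtopology (mtop M) U) (top_of_set (\<phi> ` U)) \<phi>) \<and>
    (\<forall>(U, \<phi>)\<in>charts M. \<forall>(W, \<psi>)\<in>charts M. \<forall>i.
        cholo_on (model M) (\<phi> ` (U \<inter> W)) (\<lambda>z. \<psi> (inv_into U \<phi> z) $ i))"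

definition vec_pair :: "complex ^ 'n::finite \<Rightarrow> complex ^ 'm::finite \<Rightarrow> complex ^ ('n + 'm)"
  where "vec_pair a b = (\<chi> i. case i of Inl j \<Rightarrow> a $ j | Inr k \<Rightarrow> b $ k)"

definition prod_manifold ::
    "('v, 'n::finite) cmanifold \<Rightarrow> ('w, 'm::finite) cmanifold \<Rightarrow> ('v \<times> 'w, 'n + 'm) cmanifold"
  where "prod_manifold M N =
    \<lparr>mtop = prod_topology (mtop M) (mtop N),
     model = {vec_pair a b | a b. a \<in> model M \<and> b \<in> model N},
     charts = {(U \<times> W, \<lambda>(x, y). vec_pair (\<phi> x) (\<psi> y)) | U \<phi> W \<psi>.
                 (U, \<phi>) \<in> charts M \<and> (W, \<psi>) \<in> charts N}\<rparr>"

definition holo_map ::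
    "('v, 'n::finite) cmanifold \<Rightarrow> ('w, 'm::finite) cmanifold \<Rightarrow> ('v \<Rightarrow> 'w) \<Rightarrow> bool"
  where "holo_map M N F \<longleftrightarrow>
    continuous_map (mtop M) (mtop N) F \<and>
    (\<forall>(U, \<phi>)\<in>charts M. \<forall>(W, \<psi>)\<in>charts N. \<forall>i.
        cholo_on (model M) (\<phi> ` (U \<inter> F -` W)) (\<lambda>z. \<psi> (F (inv_into U \<phi> z)) $ i))"

text \<open>Second countability is not required.\<close>

definition complex_lie_group :: "'v monoid \<Rightarrow> ('v, 'n::finite) cmanifold \<Rightarrow> bool"
  where "complex_lie_group G M \<longleftrightarrow>
    group G \<and> complex_manifold M \<and> topspace (mtop M) = carrier G \<and>
    holo_map (prod_manifold M M) M (\<lambda>(x, y). x \<otimes>\<^bsub>G\<^esub> y) \<and>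
    holo_map M M (\<lambda>x. inv\<^bsub>G\<^esub> x)"

section \<open>Holomorphic and meromorphic germs\<close>

definition holo_fun_on :: "('v, 'n::finite) cmanifold \<Rightarrow> 'v set \<Rightarrow> ('v \<Rightarrow> complex) \<Rightarrow> bool"
  where "holo_fun_on M W f \<longleftrightarrow>
    openin (mtop M) W \<and>
    (\<forall>(U, \<phi>)\<in>charts M. cholo_on (model M) (\<phi> ` (U \<inter> W)) (\<lambda>z. f (inv_into U \<phi> z)))"

definition holo_at :: "('v, 'n::finite) cmanifold \<Rightarrow> 'v \<Rightarrow> ('v \<Rightarrow> complex) \<Rightarrow> bool"
  where "holo_at M x f \<longleftrightarrow> (\<exists>W. x \<in> W \<and> holo_fun_on M W f)"

definition global_holo :: "('v, 'n::finite) cmanifold \<Rightarrow> ('v \<Rightarrow> complex) set"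
  where "global_holo M = {f. holo_fun_on M (topspace (mtop M)) f}"

text \<open>
  The stalk of the sheaf of meromorphic functions at \<open>x\<close> is the total ring of fractions of the
  ring of holomorphic germs at \<open>x\<close> (its quotient field, as the latter is a domain).  Denominators
  are the functions whose germ is not a zero divisor.  Fractions are pairs of functions holomorphic
  near \<open>x\<close>; passing to germs and passing to fractions is done by a single equivalence relation.
\<close>

definition denom_at :: "('v, 'n::finite) cmanifold \<Rightarrow> 'v \<Rightarrow> ('v \<Rightarrow> complex) \<Rightarrow> bool"
  where "denom_at M x h \<longleftrightarrow> holo_at M x h \<and>
    (\<forall>g. holo_at M x g \<and> (\<forall>\<^sub>F y in nhdsin (mtop M) x. g y * h y = 0)
           \<longrightarrow> (\<forall>\<^sub>F y in nhdsin (mtop M) x. g y = 0))"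

type_synonym 'v fraction = "('v \<Rightarrow> complex) \<times> ('v \<Rightarrow> complex)"

definition fractions_at :: "('v, 'n::finite) cmanifold \<Rightarrow> 'v \<Rightarrow> 'v fraction set"
  where "fractions_at M x = {(g, h). holo_at M x g \<and> denom_at M x h}"

definition fraction_rel :: "('v, 'n::finite) cmanifold \<Rightarrow> 'v \<Rightarrow> ('v fraction \<times> 'v fraction) set"
  where "fraction_rel M x = {((g, h), (g', h')).
    (g, h) \<in> fractions_at M x \<and> (g', h') \<in> fractions_at M x \<and>
    (\<forall>\<^sub>F y in nhdsin (mtop M) x. g y * h' y = g' y * h y)}"

definition quot_germ ::
    "('v, 'n::finite) cmanifold \<Rightarrow> 'v \<Rightarrow> ('v \<Rightarrow> complex) \<Rightarrow> ('v \<Rightarrow> complex) \<Rightarrow> 'v fraction set"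
  where "quot_germ M x g h = fraction_rel M x `` {(g, h)}"

definition mero_stalk :: "('v, 'n::finite) cmanifold \<Rightarrow> 'v \<Rightarrow> 'v fraction set ring"
  where "mero_stalk M x =
    \<lparr>carrier = fractions_at M x // fraction_rel M x,
     mult = (\<lambda>a b. \<Union>(g, h)\<in>a. \<Union>(g', h')\<in>b. quot_germ M x (\<lambda>y. g y * g' y) (\<lambda>y. h y * h' y)),
     one = quot_germ M x (\<lambda>_. 1) (\<lambda>_. 1),
     zero = quot_germ M x (\<lambda>_. 0) (\<lambda>_. 1),
     add = (\<lambda>a b. \<Union>(g, h)\<in>a. \<Union>(g', h')\<in>b.
              quot_germ M x (\<lambda>y. g y * h' y + g' y * h y) (\<lambda>y. h y * h' y))\<rparr>"

text \<open>The germs with denominator 1 are the holomorphic ones: \<open>f\<close> is identified with \<open>f / 1\<close>.\<close>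

definition holo_stalk :: "('v, 'n::finite) cmanifold \<Rightarrow> 'v \<Rightarrow> 'v fraction set ring"
  where "holo_stalk M x =
    (mero_stalk M x)\<lparr>carrier := {quot_germ M x f (\<lambda>_. 1) | f. holo_at M x f}\<rparr>"

definition max_ideal :: "('v, 'n::finite) cmanifold \<Rightarrow> 'v \<Rightarrow> 'v fraction set set"
  where "max_ideal M x = {quot_germ M x f (\<lambda>_. 1) | f. holo_at M x f \<and> f x = 0}"

text \<open>Meromorphic functions on the whole manifold: global sections of the sheaf with these stalks.\<close>

definition mero_functions :: "('v, 'n::finite) cmanifold \<Rightarrow> ('v \<Rightarrow> 'v fraction set) set"
  where "mero_functions M =
    {s \<in> (\<Pi>\<^sub>E x\<in>topspace (mtop M). carrier (mero_stalk M x)).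
       \<forall>x\<in>topspace (mtop M). \<exists>W g h. x \<in> W \<and> holo_fun_on M W g \<and> holo_fun_on M W h \<and>
         (\<forall>y\<in>W. denom_at M y h \<and> s y = quot_germ M y g h)}"

definition mero_ring :: "('v, 'n::finite) cmanifold \<Rightarrow> ('v \<Rightarrow> 'v fraction set) ring"
  where "mero_ring M =
    \<lparr>carrier = mero_functions M,
     mult = (\<lambda>s t. \<lambda>x\<in>topspace (mtop M). s x \<otimes>\<^bsub>mero_stalk M x\<^esub> t x),
     one = (\<lambda>x\<in>topspace (mtop M). \<one>\<^bsub>mero_stalk M x\<^esub>),
     zero = (\<lambda>x\<in>topspace (mtop M). \<zero>\<^bsub>mero_stalk M x\<^esub>),
     add = (\<lambda>s t. \<lambda>x\<in>topspace (mtop M). s x \<oplus>\<^bsub>mero_stalk M x\<^esub> t x)\<rparr>"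

definition mero_of_holo ::
    "('v, 'n::finite) cmanifold \<Rightarrow> ('v \<Rightarrow> complex) \<Rightarrow> 'v \<Rightarrow> 'v fraction set"
  where "mero_of_holo M f = (\<lambda>x\<in>topspace (mtop M). quot_germ M x f (\<lambda>_. 1))"

section \<open>The skew group ring and its action on germs\<close>

definition translate_germ ::
    "'v monoid \<Rightarrow> ('v, 'n::finite) cmanifold \<Rightarrow> 'v \<Rightarrow> 'v \<Rightarrow> 'v fraction set \<Rightarrow> 'v fraction set"
  \<comment> \<open>translation by \<open>\<xi>\<close>, from the stalk at \<open>x\<close> to the stalk at \<open>\<xi> x\<close>\<close>
  where "translate_germ G M \<xi> x a =
    (\<Union>(g, h)\<in>a. quot_germ M (\<xi> \<otimes>\<^bsub>G\<^esub> x)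
       (\<lambda>y. g (inv\<^bsub>G\<^esub> \<xi> \<otimes>\<^bsub>G\<^esub> y)) (\<lambda>y. h (inv\<^bsub>G\<^esub> \<xi> \<otimes>\<^bsub>G\<^esub> y)))"

definition translate_mero ::
    "'v monoid \<Rightarrow> ('v, 'n::finite) cmanifold \<Rightarrow> 'v \<Rightarrow> ('v \<Rightarrow> 'v fraction set) \<Rightarrow> 'v \<Rightarrow> 'v fraction set"
  where "translate_mero G M \<xi> s =
    (\<lambda>x\<in>carrier G. translate_germ G M \<xi> (inv\<^bsub>G\<^esub> \<xi> \<otimes>\<^bsub>G\<^esub> x) (s (inv\<^bsub>G\<^esub> \<xi> \<otimes>\<^bsub>G\<^esub> x)))"

text \<open>A finite sum of terms \<open>f\<^sub>\<xi> \<phi>\<^sub>\<xi>\<close> is represented by its coefficient function \<open>\<xi> \<mapsto> f\<^sub>\<xi>\<close>.\<close>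

type_synonym 'v skew = "'v \<Rightarrow> 'v \<Rightarrow> 'v fraction set"

definition skew_supp :: "'v monoid \<Rightarrow> ('v, 'n::finite) cmanifold \<Rightarrow> 'v skew \<Rightarrow> 'v set"
  where "skew_supp G M A = {\<xi> \<in> carrier G. A \<xi> \<noteq> \<zero>\<^bsub>mero_ring M\<^esub>}"

definition skew_term ::
    "'v monoid \<Rightarrow> ('v, 'n::finite) cmanifold \<Rightarrow> ('v \<Rightarrow> 'v fraction set) \<Rightarrow> 'v \<Rightarrow> 'v skew"
  \<comment> \<open>the element \<open>f \<phi>\<^sub>\<xi>\<close>\<close>
  where "skew_term G M f \<xi> = (\<lambda>\<zeta>\<in>carrier G. if \<zeta> = \<xi> then f else \<zero>\<^bsub>mero_ring M\<^esub>)"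

definition skew_ring :: "'v monoid \<Rightarrow> ('v, 'n::finite) cmanifold \<Rightarrow> 'v skew ring"
  where "skew_ring G M =
    \<lparr>carrier = {A \<in> carrier G \<rightarrow>\<^sub>E carrier (mero_ring M). finite (skew_supp G M A)},
     mult = (\<lambda>A B. \<lambda>\<zeta>\<in>carrier G. \<Oplus>\<^bsub>mero_ring M\<^esub>\<xi>\<in>skew_supp G M A.
               A \<xi> \<otimes>\<^bsub>mero_ring M\<^esub> translate_mero G M \<xi> (B (inv\<^bsub>G\<^esub> \<xi> \<otimes>\<^bsub>G\<^esub> \<zeta>))),
     one = skew_term G M \<one>\<^bsub>mero_ring M\<^esub> \<one>\<^bsub>G\<^esub>,
     zero = (\<lambda>\<zeta>\<in>carrier G. \<zero>\<^bsub>mero_ring M\<^esub>),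
     add = (\<lambda>A B. \<lambda>\<zeta>\<in>carrier G. A \<zeta> \<oplus>\<^bsub>mero_ring M\<^esub> B \<zeta>)\<rparr>"

text \<open>
  A global holomorphic function \<open>f\<close> is embedded as \<open>f \<phi>\<^sub>e\<close>.  The constants are among these,
  so the subring generated by them and by \<open>Es\<close> is the complex subalgebra generated.
\<close>

definition skew_subalgebra ::
    "'v monoid \<Rightarrow> ('v, 'n::finite) cmanifold \<Rightarrow> 'v skew set \<Rightarrow> 'v skew set"
  where "skew_subalgebra G M Es =
    generate_ring (skew_ring G M)
      ((\<lambda>f. skew_term G M (mero_of_holo M f) \<one>\<^bsub>G\<^esub>) ` global_holo M \<union> Es)"

definition mero_sum :: "'v monoid \<Rightarrow> ('v, 'n::finite) cmanifold \<Rightarrow> ('v \<Rightarrow> 'v fraction set) monoid"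
  \<comment> \<open>the direct sum of the stalks of meromorphic germs at all points\<close>
  where "mero_sum G M = sum_group (carrier G) (\<lambda>x. add_monoid (mero_stalk M x))"

definition skew_act ::
    "'v monoid \<Rightarrow> ('v, 'n::finite) cmanifold \<Rightarrow> 'v skew \<Rightarrow>
     ('v \<Rightarrow> 'v fraction set) \<Rightarrow> 'v \<Rightarrow> 'v fraction set"
  where "skew_act G M A F = (\<lambda>y\<in>carrier G. \<Oplus>\<^bsub>mero_stalk M y\<^esub>\<xi>\<in>skew_supp G M A.
    A \<xi> y \<otimes>\<^bsub>mero_stalk M y\<^esub>
      translate_germ G M \<xi> (inv\<^bsub>G\<^esub> \<xi> \<otimes>\<^bsub>G\<^esub> y) (F (inv\<^bsub>G\<^esub> \<xi> \<otimes>\<^bsub>G\<^esub> y)))"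

definition holo_sum ::
    "'v monoid \<Rightarrow> ('v, 'n::finite) cmanifold \<Rightarrow> 'v set \<Rightarrow> ('v \<Rightarrow> 'v fraction set) set"
  \<comment> \<open>the direct sum of the stalks of holomorphic germs at the points of \<open>S\<close>\<close>
  where "holo_sum G M S = {F \<in> carrier (mero_sum G M).
    (\<forall>x\<in>S. F x \<in> carrier (holo_stalk M x)) \<and>
    (\<forall>x\<in>carrier G - S. F x = \<zero>\<^bsub>mero_stalk M x\<^esub>)}"

section \<open>The module of points\<close>

definition point_module ::
    "('v, 'n::finite) cmanifold \<Rightarrow> 'v set \<Rightarrow> ('v \<Rightarrow> 'v fraction set set) monoid"
  where "point_module M S = sum_group S (\<lambda>x. add_monoid (holo_stalk M x Quot max_ideal M x))"

definition point_proj ::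
    "('v, 'n::finite) cmanifold \<Rightarrow> 'v set \<Rightarrow> ('v \<Rightarrow> 'v fraction set) \<Rightarrow> 'v \<Rightarrow> 'v fraction set set"
  where "point_proj M S F = (\<lambda>x\<in>S. max_ideal M x +>\<^bsub>holo_stalk M x\<^esub> F x)"

text \<open>
  The induced action: lift along the projection, act, project.  If \<open>A\<close> preserves \<open>holo_sum G M S\<close>,
  its coefficients are holomorphic at the relevant points, so the result does not depend on the lift.
\<close>

definition point_act ::
    "'v monoid \<Rightarrow> ('v, 'n::finite) cmanifold \<Rightarrow> 'v set \<Rightarrow> 'v skew \<Rightarrow>
     ('v \<Rightarrow> 'v fraction set set) \<Rightarrow> 'v \<Rightarrow> 'v fraction set set"
  where "point_act G M S A u =
    point_proj M S (skew_act G M A (inv_into (holo_sum G M S) (point_proj M S) u))"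

text \<open>Modules over the set \<open>R\<close> of operators; the group \<open>P\<close> is written multiplicatively.\<close>

definition submodule_of ::
    "'r set \<Rightarrow> ('u, 'k) monoid_scheme \<Rightarrow> ('r \<Rightarrow> 'u \<Rightarrow> 'u) \<Rightarrow> 'u set \<Rightarrow> bool"
  where "submodule_of R P act N \<longleftrightarrow> subgroup N P \<and> (\<forall>r\<in>R. \<forall>u\<in>N. act r u \<in> N)"

definition irreducible_module ::
    "'r set \<Rightarrow> ('u, 'k) monoid_scheme \<Rightarrow> ('r \<Rightarrow> 'u \<Rightarrow> 'u) \<Rightarrow> bool"
  where "irreducible_module R P act \<longleftrightarrow>
    carrier P \<noteq> {\<one>\<^bsub>P\<^esub>} \<and>
    submodule_of R P act (carrier P) \<and>
    (\<forall>N. submodule_of R P act N \<longrightarrow> N = {\<one>\<^bsub>P\<^esub>} \<or> N = carrier P)"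

definition submonoid_generated :: "'v monoid \<Rightarrow> 'v set \<Rightarrow> 'v set"
  where "submonoid_generated G X = (\<lambda>H. submonoid H G) hull X"

end

theory Submission
  imports Defs
begin

text \<open>
  Write \<open>S\<close> for the orbit.  The residue field at each point is \<^typ>\<open>complex\<close>, so the module of points is
  the space of finitely supported functions \<open>u\<close> on \<open>S\<close>; \<open>point_vec\<close> is the identification.  In these
  terms a global holomorphic function \<open>h\<close> acts by multiplication, \<open>u \<mapsto> h u\<close> (\<open>point_act_holo\<close>), and an
  operator \<open>\<Sum> f\<^sub>\<xi> \<phi>\<^sub>\<xi>\<close> acts by \<open>(A u) y = (\<Sum>\<xi>. f\<^sub>\<xi> y * u (\<xi>\<inverse> y))\<close>, as long as the coefficients are
  holomorphic on \<open>S\<close> (\<open>point_act_eq\<close>).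

  For the generators \<open>E\<^sub>i\<close> this holds because the algebra preserves the holomorphic germs: apply \<open>E\<^sub>i\<close> to
  the germ 1 supported at the single point \<open>\<xi>\<inverse> y\<close>.  As the translations in \<open>E\<^sub>i\<close> are distinct, the
  component of the result at \<open>y\<close> is exactly the coefficient of \<open>\<phi>\<^sub>\<xi>\<close>, which is therefore holomorphic
  (\<open>coefficient_holomorphic\<close>).  Its value at \<open>y\<close> is nonzero by assumption.

  Now let \<open>N\<close> be a nonzero submodule and \<open>u \<in> N\<close> with \<open>u x \<noteq> 0\<close>.  Since holomorphic functions separate
  the points of \<open>S\<close>, multiplying \<open>u\<close> by functions \<open>h - h y\<close> kills its support points other than \<open>x\<close> one
  by one, so the delta function at \<open>x\<close> lies in \<open>N\<close> (\<open>separated_delta\<close>).  Applying \<open>E\<^sub>i\<close> to it gives a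
  function that does not vanish at \<open>\<xi>\<^sub>i\<^sub>j x\<close>, so the delta function there lies in \<open>N\<close> too.  Hence the set of
  points whose delta functions lie in \<open>N\<close> is invariant under the monoid generated by the \<open>\<xi>\<^sub>i\<^sub>j\<close>
  (\<open>submonoid_generated_invariant\<close>).  This monoid is the whole group, which is transitive on \<open>S\<close>; so all
  delta functions lie in \<open>N\<close>, and they span the module.

  The argument rests on three facts about the encoding: the stalks are commutative rings
  (\<open>mero_stalk_cring\<close>), left translations are holomorphic in charts and therefore act on germs
  (\<open>translate_holo_germ\<close>), and a finite sum of terms \<open>f \<phi>\<^sub>\<xi>\<close> with distinct \<open>\<xi>\<close> has the expected
  coefficients (\<open>skew_sum_coeffs\<close>).
\<close>

section \<open>Rings of germs\<close>

lemma cholo_on_subset: "cholo_on E S f \<Longrightarrow> T \<subseteq> S \<Longrightarrow> cholo_on E T f"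
  unfolding cholo_on_def by blast

lemma cholo_on_const: "cholo_on E S (\<lambda>_. c)"
  unfolding cholo_on_def by (auto intro!: exI[of _ "\<lambda>_. 0"])

lemma cholo_on_add:
  assumes "cholo_on E S f" "cholo_on E S g"
  shows "cholo_on E S (\<lambda>z. f z + g z)"
  unfolding cholo_on_def
proof
  fix z assume z: "z \<in> S"
  obtain D where D: "(f has_derivative D) (at z within E)" "\<forall>c w. D (c *s w) = c * D w"
    using assms(1) z unfolding cholo_on_def by blast
  obtain D' where D': "(g has_derivative D') (at z within E)" "\<forall>c w. D' (c *s w) = c * D' w"
    using assms(2) z unfolding cholo_on_def by blast
  show "\<exists>D. ((\<lambda>z. f z + g z) has_derivative D) (at z within E) \<and> (\<forall>c w. D (c *s w) = c * D w)"
    using has_derivative_add[OF D(1) D'(1)] D(2) D'(2)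
    by (intro exI[of _ "\<lambda>w. D w + D' w"]) (simp add: distrib_left)
qed

lemma cholo_on_mult:
  assumes "cholo_on E S f" "cholo_on E S g"
  shows "cholo_on E S (\<lambda>z. f z * g z)"
  unfolding cholo_on_def
proof
  fix z assume z: "z \<in> S"
  obtain D where D: "(f has_derivative D) (at z within E)" "\<forall>c w. D (c *s w) = c * D w"
    using assms(1) z unfolding cholo_on_def by blast
  obtain D' where D': "(g has_derivative D') (at z within E)" "\<forall>c w. D' (c *s w) = c * D' w"
    using assms(2) z unfolding cholo_on_def by blast
  show "\<exists>D. ((\<lambda>z. f z * g z) has_derivative D) (at z within E) \<and> (\<forall>c w. D (c *s w) = c * D w)"
    using has_derivative_mult[OF D(1) D'(1)] D(2) D'(2)
    by (intro exI[of _ "\<lambda>w. f z * D' w + D w * g z"]) (simp add: distrib_left mult.assoc mult.left_commute)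
qed

lemma holo_fun_on_const: "openin (mtop M) W \<Longrightarrow> holo_fun_on M W (\<lambda>_. c)"
  unfolding holo_fun_on_def by (auto intro: cholo_on_const)

lemma holo_fun_on_subset:
  assumes "holo_fun_on M W f" "openin (mtop M) W'" "W' \<subseteq> W"
  shows "holo_fun_on M W' f"
  using assms unfolding holo_fun_on_def
  by (fastforce intro: cholo_on_subset)

lemma holo_fun_on_add:
  "holo_fun_on M W f \<Longrightarrow> holo_fun_on M W g \<Longrightarrow> holo_fun_on M W (\<lambda>x. f x + g x)"
  unfolding holo_fun_on_def by (fastforce intro: cholo_on_add)

lemma holo_fun_on_mult:
  "holo_fun_on M W f \<Longrightarrow> holo_fun_on M W g \<Longrightarrow> holo_fun_on M W (\<lambda>x. f x * g x)"
  unfolding holo_fun_on_def by (fastforce intro: cholo_on_mult)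

lemma holo_fun_on_Int:
  assumes "holo_fun_on M W f" "holo_fun_on M W' g"
  shows "holo_fun_on M (W \<inter> W') f" "holo_fun_on M (W \<inter> W') g"
proof -
  have "openin (mtop M) (W \<inter> W')" using assms unfolding holo_fun_on_def by auto
  then show "holo_fun_on M (W \<inter> W') f" "holo_fun_on M (W \<inter> W') g"
    using assms holo_fun_on_subset by (metis Int_lower1, metis Int_lower2)
qed

lemma holo_at_const [simp, intro]: "x \<in> topspace (mtop M) \<Longrightarrow> holo_at M x (\<lambda>_. c)"
  unfolding holo_at_def by (rule exI[of _ "topspace (mtop M)"]) (simp add: holo_fun_on_const)

lemma holo_at_add: 
  assumes "holo_at M x f" "holo_at M x g"
  shows "holo_at M x (\<lambda>y. f y + g y)"
  using assms unfolding holo_at_def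
  by (metis IntI holo_fun_on_Int holo_fun_on_add)

lemma holo_at_mult: 
  assumes "holo_at M x f" "holo_at M x g"
  shows "holo_at M x (\<lambda>y. f y * g y)"
  using assms unfolding holo_at_def
  by (metis IntI holo_fun_on_Int holo_fun_on_mult)

lemma holo_at_topspace: "holo_at M x f \<Longrightarrow> x \<in> topspace (mtop M)"
  unfolding holo_at_def holo_fun_on_def by (auto dest: openin_subset)

lemma holo_at_uminus:
  assumes "holo_at M x f"
  shows "holo_at M x (\<lambda>y. - f y)"
  using holo_at_mult[OF holo_at_const[OF holo_at_topspace[OF assms], of "-1"] assms] by simp

lemma holo_at_diff:
  assumes "holo_at M x f" "holo_at M x g"
  shows "holo_at M x (\<lambda>y. f y - g y)"
  using holo_at_add[OF assms(1) holo_at_uminus[OF assms(2)]] by simp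

lemma holo_at_sum:
  assumes "x \<in> topspace (mtop M)" "\<And>k. k \<in> K \<Longrightarrow> holo_at M x (f k)"
  shows "holo_at M x (\<lambda>y. \<Sum>k\<in>K. f k y)"
  using assms(2) by (induct K rule: infinite_finite_induct) (auto intro: holo_at_add assms(1))

lemma global_holo_at: "h \<in> global_holo M \<Longrightarrow> x \<in> topspace (mtop M) \<Longrightarrow> holo_at M x h"
  unfolding global_holo_def holo_at_def by auto

lemma denom_at_one [simp, intro]: "x \<in> topspace (mtop M) \<Longrightarrow> denom_at M x (\<lambda>_. 1)"
  unfolding denom_at_def by auto

lemma denom_at_mult:
  assumes "denom_at M x h" "denom_at M x h'"
  shows "denom_at M x (\<lambda>y. h y * h' y)"
  unfolding denom_at_def
proof (intro conjI allI impI)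
  show "holo_at M x (\<lambda>y. h y * h' y)"
    using assms unfolding denom_at_def by (auto intro: holo_at_mult)
  fix g assume g: "holo_at M x g \<and> (\<forall>\<^sub>F y in nhdsin (mtop M) x. g y * (h y * h' y) = 0)"
  have "holo_at M x (\<lambda>y. g y * h y)"
    using g assms unfolding denom_at_def by (auto intro: holo_at_mult)
  moreover have "\<forall>\<^sub>F y in nhdsin (mtop M) x. (g y * h y) * h' y = 0"
    using g by (simp add: mult.assoc)
  ultimately have "\<forall>\<^sub>F y in nhdsin (mtop M) x. g y * h y = 0"
    using assms(2) unfolding denom_at_def by blast
  then show "\<forall>\<^sub>F y in nhdsin (mtop M) x. g y = 0"
    using g assms(1) unfolding denom_at_def by blast
qed

lemma denom_at_holo: "denom_at M x h \<Longrightarrow> holo_at M x h"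
  unfolding denom_at_def by simp

text \<open>This is what makes equality of fractions transitive.\<close>

lemma denom_at_cancel:
  assumes "denom_at M x h" "holo_at M x f" "holo_at M x g"
    and "\<forall>\<^sub>F y in nhdsin (mtop M) x. f y * h y = g y * h y"
  shows "\<forall>\<^sub>F y in nhdsin (mtop M) x. f y = g y"
proof -
  have "\<forall>\<^sub>F y in nhdsin (mtop M) x. (f y - g y) * h y = 0"
    using assms(4) by (simp add: left_diff_distrib)
  then have "\<forall>\<^sub>F y in nhdsin (mtop M) x. f y - g y = 0"
    using assms(1) holo_at_diff[OF assms(2,3)] unfolding denom_at_def by blast
  then show ?thesis by simp
qed

lemmas germ_intros = holo_at_add holo_at_mult holo_at_const holo_at_uminus
  denom_at_one denom_at_mult denom_at_holo

lemma fractions_at_iff: "(g, h) \<in> fractions_at M x \<longleftrightarrow> holo_at M x g \<and> denom_at M x h"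
  unfolding fractions_at_def by simp

lemma equiv_fraction_rel: "equiv (fractions_at M x) (fraction_rel M x)"
proof (rule equivI)
  show "fraction_rel M x \<subseteq> fractions_at M x \<times> fractions_at M x"
    unfolding fraction_rel_def by auto
  show "refl_on (fractions_at M x) (fraction_rel M x)"
    unfolding fraction_rel_def refl_on_def by auto
  show "sym (fraction_rel M x)"
    unfolding fraction_rel_def sym_def by (auto elim!: eventually_mono)
  show "trans (fraction_rel M x)"
  proof (rule transI)
    fix p q r assume pq: "(p, q) \<in> fraction_rel M x" and qr: "(q, r) \<in> fraction_rel M x"
    obtain g h g' h' g'' h'' where eq: "p = (g, h)" "q = (g', h')" "r = (g'', h'')"
      by (metis surj_pair)
    have f: "holo_at M x g" "denom_at M x h" "denom_at M x h'" "holo_at M x g''" "denom_at M x h''"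
      using pq qr unfolding fraction_rel_def eq fractions_at_def by auto
    have "\<forall>\<^sub>F y in nhdsin (mtop M) x. (g y * h'' y) * h' y = (g'' y * h y) * h' y"
    proof -
      have "\<forall>\<^sub>F y in nhdsin (mtop M) x. g y * h' y = g' y * h y"
        and "\<forall>\<^sub>F y in nhdsin (mtop M) x. g' y * h'' y = g'' y * h' y"
        using pq qr unfolding fraction_rel_def eq by auto
      then show ?thesis
      proof (rule eventually_elim2)
        fix y assume "g y * h' y = g' y * h y" "g' y * h'' y = g'' y * h' y"
        then have "(g y * h' y) * h'' y = (g'' y * h' y) * h y"
          by (metis mult.assoc mult.commute)
        then show "(g y * h'' y) * h' y = (g'' y * h y) * h' y" by (simp add: ac_simps)
      qed
    qed
    then have "\<forall>\<^sub>F y in nhdsin (mtop M) x. g y * h'' y = g'' y * h y"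
      using denom_at_cancel[OF f(3) holo_at_mult[OF f(1) denom_at_holo[OF f(5)]]
        holo_at_mult[OF f(4) denom_at_holo[OF f(2)]]] by blast
    then show "(p, r) \<in> fraction_rel M x"
      using f unfolding fraction_rel_def eq fractions_at_def by auto
  qed
qed

lemma quot_germ_eq_iff:
  assumes "holo_at M x g" "denom_at M x h" "holo_at M x g'" "denom_at M x h'"
  shows "quot_germ M x g h = quot_germ M x g' h' \<longleftrightarrow>
    (\<forall>\<^sub>F y in nhdsin (mtop M) x. g y * h' y = g' y * h y)"
proof -
  have "quot_germ M x g h = quot_germ M x g' h' \<longleftrightarrow> ((g, h), (g', h')) \<in> fraction_rel M x"
    unfolding quot_germ_def
    by (rule eq_equiv_class_iff[OF equiv_fraction_rel]) (use assms in \<open>simp_all add: fractions_at_iff\<close>)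
  then show ?thesis
    using assms unfolding fraction_rel_def by (auto simp: fractions_at_iff)
qed

lemma mem_quot_germ:
  assumes "(g', h') \<in> quot_germ M x g h"
  shows "holo_at M x g'" "denom_at M x h'" "holo_at M x g" "denom_at M x h"
    "\<forall>\<^sub>F y in nhdsin (mtop M) x. g y * h' y = g' y * h y"
  using assms unfolding quot_germ_def fraction_rel_def fractions_at_def by auto

lemma quot_germ_self: 
  "holo_at M x g \<Longrightarrow> denom_at M x h \<Longrightarrow> (g, h) \<in> quot_germ M x g h"
  unfolding quot_germ_def fraction_rel_def fractions_at_def by auto

lemma stalk_cases:
  assumes "a \<in> carrier (mero_stalk M x)"
  obtains g h where "holo_at M x g" "denom_at M x h" "a = quot_germ M x g h"
  using assms unfolding mero_stalk_def quot_germ_def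
  by (auto elim!: quotientE simp: fractions_at_iff)

lemma quot_germ_closed [intro]:
  "holo_at M x g \<Longrightarrow> denom_at M x h \<Longrightarrow> quot_germ M x g h \<in> carrier (mero_stalk M x)"
  unfolding mero_stalk_def quot_germ_def by (auto intro: quotientI simp: fractions_at_iff)

lemma UN_const: "c \<in> A \<Longrightarrow> (\<And>x. x \<in> A \<Longrightarrow> F x = B) \<Longrightarrow> (\<Union>x\<in>A. F x) = B"
  by blast

text \<open>The operations on stalks are unions over all pairs of representatives.  Such a union collapses once
  all pairs give the same set.\<close>

lemma UN_UN_pair_const:
  assumes "c \<in> A" "d \<in> B"
    and "\<And>k l k' l'. (k, l) \<in> A \<Longrightarrow> (k', l') \<in> B \<Longrightarrow> F k l k' l' = C"
  shows "(\<Union>(k, l)\<in>A. \<Union>(k', l')\<in>B. F k l k' l') = C"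
proof -
  have "(\<Union>(k', l')\<in>B. F k l k' l') = C" if "(k, l) \<in> A" for k l
    by (rule UN_const[OF assms(2)]) (use that assms(3) in \<open>clarsimp\<close>)
  then show ?thesis
    by (intro UN_const[OF assms(1)]) clarsimp
qed

lemma quot_germ_mult:
  assumes "holo_at M x g" "denom_at M x h" "holo_at M x g'" "denom_at M x h'"
  shows "quot_germ M x g h \<otimes>\<^bsub>mero_stalk M x\<^esub> quot_germ M x g' h' =
    quot_germ M x (\<lambda>y. g y * g' y) (\<lambda>y. h y * h' y)"
proof -
  have "quot_germ M x (\<lambda>y. k y * k' y) (\<lambda>y. l y * l' y) =
      quot_germ M x (\<lambda>y. g y * g' y) (\<lambda>y. h y * h' y)"
    if "(k, l) \<in> quot_germ M x g h" "(k', l') \<in> quot_germ M x g' h'" for k l k' l'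
    using mem_quot_germ(1,2)[OF that(1)] mem_quot_germ(1,2)[OF that(2)]
  proof (subst quot_germ_eq_iff)
    show "\<forall>\<^sub>F y in nhdsin (mtop M) x. k y * k' y * (h y * h' y) = g y * g' y * (l y * l' y)"
      using mem_quot_germ(5)[OF that(1)] mem_quot_germ(5)[OF that(2)]
    proof (rule eventually_elim2)
      fix y assume "g y * l y = k y * h y" "g' y * l' y = k' y * h' y"
      then have "(k y * h y) * (k' y * h' y) = (g y * l y) * (g' y * l' y)" by simp
      then show "k y * k' y * (h y * h' y) = g y * g' y * (l y * l' y)" by (simp add: ac_simps)
    qed
  qed (use assms in \<open>simp_all add: germ_intros\<close>)
  then show ?thesis
    unfolding mero_stalk_def monoid.select_convs ring.select_convs
    by (rule UN_UN_pair_const[OF quot_germ_self[OF assms(1,2)] quot_germ_self[OF assms(3,4)]])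
qed

lemma quot_germ_add:
  assumes "holo_at M x g" "denom_at M x h" "holo_at M x g'" "denom_at M x h'"
  shows "quot_germ M x g h \<oplus>\<^bsub>mero_stalk M x\<^esub> quot_germ M x g' h' =
    quot_germ M x (\<lambda>y. g y * h' y + g' y * h y) (\<lambda>y. h y * h' y)"
proof -
  have "quot_germ M x (\<lambda>y. k y * l' y + k' y * l y) (\<lambda>y. l y * l' y) =
      quot_germ M x (\<lambda>y. g y * h' y + g' y * h y) (\<lambda>y. h y * h' y)"
    if "(k, l) \<in> quot_germ M x g h" "(k', l') \<in> quot_germ M x g' h'" for k l k' l'
    using mem_quot_germ(1,2)[OF that(1)] mem_quot_germ(1,2)[OF that(2)]
  proof (subst quot_germ_eq_iff)
    show "\<forall>\<^sub>F y in nhdsin (mtop M) x. (k y * l' y + k' y * l y) * (h y * h' y) =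
        (g y * h' y + g' y * h y) * (l y * l' y)"
      using mem_quot_germ(5)[OF that(1)] mem_quot_germ(5)[OF that(2)]
    proof (rule eventually_elim2)
      fix y assume "g y * l y = k y * h y" "g' y * l' y = k' y * h' y"
      then have "(k y * h y) * (l' y * h' y) + (k' y * h' y) * (l y * h y) =
          (g y * l y) * (l' y * h' y) + (g' y * l' y) * (l y * h y)" by simp
      then show "(k y * l' y + k' y * l y) * (h y * h' y) =
        (g y * h' y + g' y * h y) * (l y * l' y)" by (simp add: algebra_simps)
    qed
  qed (use assms in \<open>simp_all add: germ_intros\<close>)
  then show ?thesis
    unfolding mero_stalk_def monoid.select_convs ring.select_convs
    by (rule UN_UN_pair_const[OF quot_germ_self[OF assms(1,2)] quot_germ_self[OF assms(3,4)]])
qed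

lemma mero_stalk_zero: "\<zero>\<^bsub>mero_stalk M x\<^esub> = quot_germ M x (\<lambda>_. 0) (\<lambda>_. 1)"
  and mero_stalk_one: "\<one>\<^bsub>mero_stalk M x\<^esub> = quot_germ M x (\<lambda>_. 1) (\<lambda>_. 1)"
  unfolding mero_stalk_def by simp_all

lemma quot_germ_cong:
  assumes "holo_at M x g" "denom_at M x h" "holo_at M x g'" "denom_at M x h'"
    and "\<And>y. g y * h' y = g' y * h y"
  shows "quot_germ M x g h = quot_germ M x g' h'"
  using assms by (simp add: quot_germ_eq_iff)

lemmas germ_ops = quot_germ_mult quot_germ_add mero_stalk_zero mero_stalk_one quot_germ_closed
  germ_intros

lemma mero_stalk_cring:
  assumes x: "x \<in> topspace (mtop M)"
  shows "cring (mero_stalk M x)"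
proof (rule cringI)
  show "abelian_group (mero_stalk M x)"
  proof (rule abelian_groupI)
    fix a assume "a \<in> carrier (mero_stalk M x)"
    then obtain g h where a: "holo_at M x g" "denom_at M x h" "a = quot_germ M x g h"
      by (rule stalk_cases)
    show "\<zero>\<^bsub>mero_stalk M x\<^esub> \<oplus>\<^bsub>mero_stalk M x\<^esub> a = a"
      using x a(1,2) unfolding a(3) by (simp add: germ_ops)
    have "quot_germ M x (\<lambda>y. - g y) h \<oplus>\<^bsub>mero_stalk M x\<^esub> a = \<zero>\<^bsub>mero_stalk M x\<^esub>"
      using x a(1,2) unfolding a(3) 
      by (simp add: quot_germ_add mero_stalk_zero germ_intros) (intro quot_germ_cong; simp add: germ_intros)
    then show "\<exists>b\<in>carrier (mero_stalk M x). b \<oplus>\<^bsub>mero_stalk M x\<^esub> a = \<zero>\<^bsub>mero_stalk M x\<^esub>"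
      using a by (auto intro: quot_germ_closed holo_at_uminus)
    fix b assume "b \<in> carrier (mero_stalk M x)"
    then obtain g' h' where b: "holo_at M x g'" "denom_at M x h'" "b = quot_germ M x g' h'"
      by (rule stalk_cases)
    show "a \<oplus>\<^bsub>mero_stalk M x\<^esub> b \<in> carrier (mero_stalk M x)"
      using a(1,2) b(1,2) unfolding a(3) b(3) by (simp add: germ_ops)
    show "a \<oplus>\<^bsub>mero_stalk M x\<^esub> b = b \<oplus>\<^bsub>mero_stalk M x\<^esub> a"
      using a(1,2) b(1,2) unfolding a(3) b(3) by (simp add: germ_ops add.commute mult.commute)
    fix c assume "c \<in> carrier (mero_stalk M x)"
    then obtain g'' h'' where c: "holo_at M x g''" "denom_at M x h''" "c = quot_germ M x g'' h''"
      by (rule stalk_cases)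
    show "a \<oplus>\<^bsub>mero_stalk M x\<^esub> b \<oplus>\<^bsub>mero_stalk M x\<^esub> c =
        a \<oplus>\<^bsub>mero_stalk M x\<^esub> (b \<oplus>\<^bsub>mero_stalk M x\<^esub> c)"
      using a(1,2) b(1,2) c(1,2) unfolding a(3) b(3) c(3)
      by (simp add: germ_ops) (simp add: algebra_simps)
  next
    show "\<zero>\<^bsub>mero_stalk M x\<^esub> \<in> carrier (mero_stalk M x)"
      using x by (simp add: germ_ops)
  qed
  show "comm_monoid (mero_stalk M x)"
  proof (rule comm_monoidI)
    fix a assume "a \<in> carrier (mero_stalk M x)"
    then obtain g h where a: "holo_at M x g" "denom_at M x h" "a = quot_germ M x g h"
      by (rule stalk_cases)
    show "\<one>\<^bsub>mero_stalk M x\<^esub> \<otimes>\<^bsub>mero_stalk M x\<^esub> a = a"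
      using x a(1,2) unfolding a(3) by (simp add: germ_ops)
    fix b assume "b \<in> carrier (mero_stalk M x)"
    then obtain g' h' where b: "holo_at M x g'" "denom_at M x h'" "b = quot_germ M x g' h'"
      by (rule stalk_cases)
    show "a \<otimes>\<^bsub>mero_stalk M x\<^esub> b \<in> carrier (mero_stalk M x)"
      using a(1,2) b(1,2) unfolding a(3) b(3) by (simp add: germ_ops)
    show "a \<otimes>\<^bsub>mero_stalk M x\<^esub> b = b \<otimes>\<^bsub>mero_stalk M x\<^esub> a"
      using a(1,2) b(1,2) unfolding a(3) b(3) by (simp add: germ_ops mult.commute)
    fix c assume "c \<in> carrier (mero_stalk M x)"
    then obtain g'' h'' where c: "holo_at M x g''" "denom_at M x h''" "c = quot_germ M x g'' h''"
      by (rule stalk_cases)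
    show "a \<otimes>\<^bsub>mero_stalk M x\<^esub> b \<otimes>\<^bsub>mero_stalk M x\<^esub> c =
        a \<otimes>\<^bsub>mero_stalk M x\<^esub> (b \<otimes>\<^bsub>mero_stalk M x\<^esub> c)"
      using a(1,2) b(1,2) c(1,2) unfolding a(3) b(3) c(3)
      by (simp add: germ_ops) (simp add: algebra_simps)
  next
    show "\<one>\<^bsub>mero_stalk M x\<^esub> \<in> carrier (mero_stalk M x)"
      using x by (simp add: germ_ops)
  qed
  fix a assume "a \<in> carrier (mero_stalk M x)"
  then obtain g h where a: "holo_at M x g" "denom_at M x h" "a = quot_germ M x g h"
    by (rule stalk_cases)
  fix b assume "b \<in> carrier (mero_stalk M x)"
  then obtain g' h' where b: "holo_at M x g'" "denom_at M x h'" "b = quot_germ M x g' h'"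
    by (rule stalk_cases)
  fix c assume "c \<in> carrier (mero_stalk M x)"
  then obtain g'' h'' where c: "holo_at M x g''" "denom_at M x h''" "c = quot_germ M x g'' h''"
    by (rule stalk_cases)
  show "(a \<oplus>\<^bsub>mero_stalk M x\<^esub> b) \<otimes>\<^bsub>mero_stalk M x\<^esub> c =
      a \<otimes>\<^bsub>mero_stalk M x\<^esub> c \<oplus>\<^bsub>mero_stalk M x\<^esub> b \<otimes>\<^bsub>mero_stalk M x\<^esub> c"
    using a(1,2) b(1,2) c(1,2) unfolding a(3) b(3) c(3)
    by (simp add: germ_ops) (rule quot_germ_cong; (simp add: germ_intros)?; simp add: algebra_simps)
qed

abbreviation holo_germ ::
    "('v, 'n::finite) cmanifold \<Rightarrow> 'v \<Rightarrow> ('v \<Rightarrow> complex) \<Rightarrow> 'v fraction set"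
  where "holo_germ M x f \<equiv> quot_germ M x f (\<lambda>_. 1)"

text \<open>The value of a holomorphic germ at its base point is well defined, since neighbourhoods of \<open>x\<close>
  contain \<open>x\<close>.\<close>

lemma holo_germ_eqD:
  assumes "holo_at M x f" "holo_at M x g" "holo_germ M x f = holo_germ M x g"
  shows "f x = g x"
proof -
  have x: "x \<in> topspace (mtop M)" using assms(1) by (rule holo_at_topspace)
  have "\<forall>\<^sub>F y in nhdsin (mtop M) x. f y * 1 = g y * 1"
    using assms x by (subst (asm) quot_germ_eq_iff) auto
  then show ?thesis using x by (auto simp: eventually_nhdsin)
qed

lemma holo_germ_mult:
  "holo_at M x f \<Longrightarrow> holo_at M x g \<Longrightarrow>
    holo_germ M x f \<otimes>\<^bsub>mero_stalk M x\<^esub> holo_germ M x g = holo_germ M x (\<lambda>y. f y * g y)"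
  by (simp add: quot_germ_mult holo_at_topspace)

lemma holo_germ_add:
  "holo_at M x f \<Longrightarrow> holo_at M x g \<Longrightarrow>
    holo_germ M x f \<oplus>\<^bsub>mero_stalk M x\<^esub> holo_germ M x g = holo_germ M x (\<lambda>y. f y + g y)"
  by (simp add: quot_germ_add holo_at_topspace)

lemma holo_germ_closed: "holo_at M x f \<Longrightarrow> holo_germ M x f \<in> carrier (mero_stalk M x)"
  by (simp add: holo_at_topspace quot_germ_closed)

lemma holo_germ_uminus:
  assumes "holo_at M x f"
  shows "\<ominus>\<^bsub>mero_stalk M x\<^esub> holo_germ M x f = holo_germ M x (\<lambda>y. - f y)"
proof -
  interpret cring "mero_stalk M x" by (rule mero_stalk_cring[OF holo_at_topspace[OF assms]])
  show ?thesis
    by (rule minus_equality)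
       (use assms in \<open>simp_all add: holo_germ_add holo_at_uminus mero_stalk_zero holo_germ_closed\<close>)
qed

lemma holo_germ_sum:
  assumes x: "x \<in> topspace (mtop M)" and "finite K" and "\<And>k. k \<in> K \<Longrightarrow> holo_at M x (f k)"
  shows "(\<Oplus>\<^bsub>mero_stalk M x\<^esub>k\<in>K. holo_germ M x (f k)) = holo_germ M x (\<lambda>y. \<Sum>k\<in>K. f k y)"
proof -
  interpret cring "mero_stalk M x" using x by (rule mero_stalk_cring)
  show ?thesis using assms(2,3)
  proof (induct K)
    case empty
    show ?case by (simp add: mero_stalk_zero)
  next
    case (insert k K)
    then show ?case
      using x by (simp add: finsum_insert holo_germ_closed holo_germ_add holo_at_sum)
  qed
qed

lemma carrier_holo_stalk: "carrier (holo_stalk M x) = {holo_germ M x f | f. holo_at M x f}"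
  unfolding holo_stalk_def by simp

lemma holo_stalk_sel [simp]:
  "add (holo_stalk M x) = add (mero_stalk M x)"
  "mult (holo_stalk M x) = mult (mero_stalk M x)"
  "zero (holo_stalk M x) = zero (mero_stalk M x)"
  "one (holo_stalk M x) = one (mero_stalk M x)"
  unfolding holo_stalk_def by simp_all

lemma holo_stalk_ring:
  assumes x: "x \<in> topspace (mtop M)"
  shows "ring (holo_stalk M x)"
proof -
  interpret cring "mero_stalk M x" using x by (rule mero_stalk_cring)
  have "subring {holo_germ M x f | f. holo_at M x f} (mero_stalk M x)"
  proof (rule subringI)
    show "{holo_germ M x f |f. holo_at M x f} \<subseteq> carrier (mero_stalk M x)"
      by (auto intro: holo_germ_closed)
    show "\<one>\<^bsub>mero_stalk M x\<^esub> \<in> {holo_germ M x f |f. holo_at M x f}"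
      using x by (auto simp: mero_stalk_one)
  qed (use holo_at_uminus holo_at_mult holo_at_add in
      \<open>fastforce simp: holo_germ_mult holo_germ_add holo_germ_uminus\<close>)+
  then show ?thesis
    unfolding holo_stalk_def by (rule subring_is_ring)
qed

lemma max_idealE:
  assumes "a \<in> max_ideal M x"
  obtains f where "holo_at M x f" "f x = 0" "a = holo_germ M x f"
  using assms unfolding max_ideal_def by blast

lemma holo_germ_mem_max_ideal:
  "holo_at M x f \<Longrightarrow> holo_germ M x f \<in> max_ideal M x \<longleftrightarrow> f x = 0"
  unfolding max_ideal_def by (auto dest: holo_germ_eqD)

lemma holo_stalk_uminus:
  assumes "holo_at M x f"
  shows "\<ominus>\<^bsub>holo_stalk M x\<^esub> holo_germ M x f = holo_germ M x (\<lambda>y. - f y)"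
proof -
  interpret ring "holo_stalk M x" by (rule holo_stalk_ring[OF holo_at_topspace[OF assms]])
  show ?thesis
    by (rule minus_equality)
       (use assms in \<open>auto simp: holo_germ_add holo_at_uminus mero_stalk_zero carrier_holo_stalk
          holo_at_topspace\<close>)
qed

lemma max_ideal_is_ideal:
  assumes x: "x \<in> topspace (mtop M)"
  shows "ideal (max_ideal M x) (holo_stalk M x)"
proof (rule idealI[OF holo_stalk_ring[OF x]])
  show "subgroup (max_ideal M x) (add_monoid (holo_stalk M x))"
  proof (rule subgroup.intro)
    show "max_ideal M x \<subseteq> carrier (add_monoid (holo_stalk M x))"
      unfolding max_ideal_def by (auto simp: carrier_holo_stalk)
    show "\<one>\<^bsub>add_monoid (holo_stalk M x)\<^esub> \<in> max_ideal M x"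
      using x unfolding max_ideal_def by (auto simp: mero_stalk_zero)
    show "a \<otimes>\<^bsub>add_monoid (holo_stalk M x)\<^esub> b \<in> max_ideal M x"
      if "a \<in> max_ideal M x" "b \<in> max_ideal M x" for a b
      using that by (auto elim!: max_idealE simp: holo_germ_add holo_germ_mem_max_ideal holo_at_add)
    show "inv\<^bsub>add_monoid (holo_stalk M x)\<^esub> a \<in> max_ideal M x" if a: "a \<in> max_ideal M x" for a
    proof -
      obtain f where "holo_at M x f" "f x = 0" "a = holo_germ M x f"
        using a unfolding max_ideal_def by blast
      then have "\<ominus>\<^bsub>holo_stalk M x\<^esub> a \<in> max_ideal M x"
        by (simp add: holo_stalk_uminus holo_germ_mem_max_ideal holo_at_uminus)
      then show ?thesis by (simp add: a_inv_def)
    qed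
  qed
qed (auto elim!: max_idealE simp: carrier_holo_stalk holo_germ_mult holo_germ_mem_max_ideal holo_at_mult)

text \<open>The residue field is \<^typ>\<open>complex\<close>: a coset of the maximal ideal is determined by a value at \<open>x\<close>.\<close>

lemma max_ideal_coset_eq_iff:
  assumes f: "holo_at M x f" and g: "holo_at M x g"
  shows "max_ideal M x +>\<^bsub>holo_stalk M x\<^esub> holo_germ M x f =
      max_ideal M x +>\<^bsub>holo_stalk M x\<^esub> holo_germ M x g \<longleftrightarrow> f x = g x"
proof -
  have x: "x \<in> topspace (mtop M)" using f by (rule holo_at_topspace)
  interpret ring "holo_stalk M x" using x by (rule holo_stalk_ring)
  have "holo_germ M x f \<ominus>\<^bsub>holo_stalk M x\<^esub> holo_germ M x g = holo_germ M x (\<lambda>y. f y - g y)"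
    using f g by (simp add: a_minus_def holo_stalk_uminus holo_germ_add holo_at_uminus)
  then have "f x = g x \<longleftrightarrow>
      holo_germ M x f \<ominus>\<^bsub>holo_stalk M x\<^esub> holo_germ M x g \<in> max_ideal M x"
    using f g by (simp add: holo_germ_mem_max_ideal holo_at_diff)
  moreover have "holo_germ M x f \<in> carrier (holo_stalk M x)"
    "holo_germ M x g \<in> carrier (holo_stalk M x)"
    using f g by (auto simp only: carrier_holo_stalk mem_Collect_eq)
  ultimately show ?thesis
    using quotient_eq_iff_same_a_r_cos[OF max_ideal_is_ideal[OF x]] by simp
qed

section \<open>Left translations of germs\<close>

lemma has_derivative_vec:
  fixes F :: "'a::real_normed_vector \<Rightarrow> complex ^ 'n::finite"
  assumes "\<And>i. ((\<lambda>z. F z $ i) has_derivative D i) (at z within S)"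
  shows "(F has_derivative (\<lambda>w. \<chi> i. D i w)) (at z within S)"
proof (subst has_derivative_componentwise_within, rule ballI)
  fix b :: "complex ^ 'n" assume "b \<in> Basis"
  then obtain i u where b: "b = axis i u" unfolding Basis_vec_def by auto
  show "((\<lambda>z. F z \<bullet> b) has_derivative (\<lambda>w. (\<chi> i. D i w) \<bullet> b)) (at z within S)"
    unfolding b inner_axis using assms[of i] by (auto intro: has_derivative_inner_left)
qed

lemma vec_pair_eq_iff: "vec_pair a b = vec_pair a' b' \<longleftrightarrow> a = a' \<and> b = b'"
  unfolding vec_pair_def vec_eq_iff by (auto split: sum.splits)

lemma vec_pair_smult: "vec_pair 0 (c *s w) = c *s vec_pair 0 w"
  unfolding vec_pair_def vec_eq_iff by (auto split: sum.splits)

lemma has_derivative_vec_pair: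
  fixes a :: "complex ^ 'm::finite" and z :: "complex ^ 'k::finite"
  shows "(vec_pair a has_derivative vec_pair 0) (at z within S)"
proof -
  have "linear (vec_pair 0 :: complex ^ 'k \<Rightarrow> complex ^ ('m + 'k))"
    by (rule linearI) (auto simp: vec_pair_def vec_eq_iff split: sum.splits)
  then have "(vec_pair 0 has_derivative (vec_pair 0 :: complex ^ 'k \<Rightarrow> complex ^ ('m + 'k))) (at z within S)"
    by (intro bounded_linear_imp_has_derivative) (simp add: linear_conv_bounded_linear)
  from has_derivative_add[OF has_derivative_const[of "vec_pair a 0"] this]
  have "((\<lambda>z. vec_pair a 0 + vec_pair 0 z) has_derivative vec_pair 0) (at z within S)"
    by simp
  moreover have "(\<lambda>z. vec_pair a 0 + vec_pair 0 z) = (vec_pair a :: complex ^ 'k \<Rightarrow> complex ^ ('m + 'k))"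
    by (auto simp: vec_pair_def vec_eq_iff split: sum.splits)
  ultimately show ?thesis by simp
qed

locale complex_lie_grp =
  fixes G :: "'v monoid" and M :: "('v, 'n::finite) cmanifold"
  assumes lie: "complex_lie_group G M"
begin

sublocale group G
  using lie unfolding complex_lie_group_def by simp

lemma topspace_eq: "topspace (mtop M) = carrier G"
  using lie unfolding complex_lie_group_def by simp

lemma manifold: "complex_manifold M"
  using lie unfolding complex_lie_group_def by simp

lemma chart_around:
  assumes "x \<in> carrier G"
  obtains U \<phi> where "(U, \<phi>) \<in> charts M" "x \<in> U"
  using assms manifold topspace_eq unfolding complex_manifold_def by blast

lemma chart:
  assumes "(U, \<phi>) \<in> charts M"
  shows "openin (mtop M) U" "U \<subseteq> carrier G" "inj_on \<phi> U" "\<phi> ` U \<subseteq> model M"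
    "\<And>W. openin (mtop M) W \<Longrightarrow> openin (top_of_set (model M)) (\<phi> ` (U \<inter> W))"
proof -
  have c: "openin (mtop M) U" "openin (top_of_set (model M)) (\<phi> ` U)"
     "homeomorphic_map (subtopology (mtop M) U) (top_of_set (\<phi> ` U)) \<phi>"
    using manifold assms unfolding complex_manifold_def by auto
  show "openin (mtop M) U" by (rule c)
  show U: "U \<subseteq> carrier G" using openin_subset[OF c(1)] topspace_eq by simp
  show "inj_on \<phi> U"
    using homeomorphic_imp_injective_map[OF c(3)] U topspace_eq by (simp add: Int_absorb1 topspace_subtopology)
  show "\<phi> ` U \<subseteq> model M" using openin_subset[OF c(2)] by simp
  fix W assume "openin (mtop M) W"
  then have "openin (subtopology (mtop M) U) (U \<inter> W)"
    by (simp add: openin_subtopology_Int2)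
  then have "openin (top_of_set (\<phi> ` U)) (\<phi> ` (U \<inter> W))"
    using homeomorphic_imp_open_map[OF c(3)] unfolding open_map_def by blast
  then show "openin (top_of_set (model M)) (\<phi> ` (U \<inter> W))"
    using c(2) openin_trans by blast
qed

lemma continuous_left_translation:
  assumes a: "a \<in> carrier G"
  shows "continuous_map (mtop M) (mtop M) (\<lambda>y. a \<otimes>\<^bsub>G\<^esub> y)"
proof -
  have m: "continuous_map (prod_topology (mtop M) (mtop M)) (mtop M) (\<lambda>(x, y). x \<otimes>\<^bsub>G\<^esub> y)"
    using lie unfolding complex_lie_group_def holo_map_def prod_manifold_def by simp
  have "continuous_map (mtop M) (prod_topology (mtop M) (mtop M)) (\<lambda>y. (a, y))"
    using a topspace_eq by (intro continuous_map_pairedI) auto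
  from continuous_map_compose[OF this m] show ?thesis by (simp add: o_def)
qed

text \<open>Left translation by \<open>a\<close> is the multiplication map precomposed with \<open>y \<mapsto> (a, y)\<close>.  In charts the
  latter is \<open>z \<mapsto> vec_pair (\<phi>\<^sub>1 a) z\<close> with derivative \<open>vec_pair 0\<close>, so the chain rule reduces the claim
  to the holomorphy of multiplication on the product manifold.\<close>

lemma cholo_left_translation:
  assumes a: "a \<in> carrier G" and c: "(U, \<phi>) \<in> charts M" and d: "(P, \<psi>) \<in> charts M"
  shows "cholo_on (model M) (\<phi> ` (U \<inter> {y. a \<otimes>\<^bsub>G\<^esub> y \<in> P})) (\<lambda>z. \<psi> (a \<otimes>\<^bsub>G\<^esub> inv_into U \<phi> z) $ i)"
  unfolding cholo_on_def
proof
  fix z assume "z \<in> \<phi> ` (U \<inter> {y. a \<otimes>\<^bsub>G\<^esub> y \<in> P})"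
  then obtain y where y: "y \<in> U" "a \<otimes>\<^bsub>G\<^esub> y \<in> P" "z = \<phi> y" by blast
  obtain U1 \<phi>1 where c1: "(U1, \<phi>1) \<in> charts M" "a \<in> U1" using a by (rule chart_around)
  define \<Phi> where "\<Phi> = (\<lambda>(x, y). vec_pair (\<phi>1 x) (\<phi> y))"
  have "(U1 \<times> U, \<Phi>) \<in> charts (prod_manifold M M)"
    using c c1 unfolding prod_manifold_def \<Phi>_def by auto
  moreover have "holo_map (prod_manifold M M) M (\<lambda>(x, y). x \<otimes>\<^bsub>G\<^esub> y)"
    using lie unfolding complex_lie_group_def by simp
  ultimately have "cholo_on (model (prod_manifold M M))
      (\<Phi> ` (U1 \<times> U \<inter> (\<lambda>(x, y). x \<otimes>\<^bsub>G\<^esub> y) -` P))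
      (\<lambda>z. \<psi> ((\<lambda>(x, y). x \<otimes>\<^bsub>G\<^esub> y) (inv_into (U1 \<times> U) \<Phi> z)) $ i)"
    using d unfolding holo_map_def by blast
  moreover have "vec_pair (\<phi>1 a) z \<in> \<Phi> ` (U1 \<times> U \<inter> (\<lambda>(x, y). x \<otimes>\<^bsub>G\<^esub> y) -` P)"
    using y c1 unfolding \<Phi>_def by (intro image_eqI[of _ _ "(a, y)"]) auto
  ultimately obtain D where
    D: "((\<lambda>z. \<psi> ((\<lambda>(x, y). x \<otimes>\<^bsub>G\<^esub> y) (inv_into (U1 \<times> U) \<Phi> z)) $ i) has_derivative D)
        (at (vec_pair (\<phi>1 a) z) within model (prod_manifold M M))"
    and Ds: "\<And>c w. D (c *s w) = c * D w"
    unfolding cholo_on_def by blast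
  have "vec_pair (\<phi>1 a) ` model M \<subseteq> model (prod_manifold M M)"
    using chart(4)[OF c1(1)] c1(2) unfolding prod_manifold_def by auto
  then have D': "((\<lambda>z. \<psi> ((\<lambda>(x, y). x \<otimes>\<^bsub>G\<^esub> y) (inv_into (U1 \<times> U) \<Phi> (vec_pair (\<phi>1 a) z))) $ i)
      has_derivative (\<lambda>w. D (vec_pair 0 w))) (at z within model M)"
    by (intro has_derivative_in_compose[OF has_derivative_vec_pair has_derivative_subset[OF D]])
  have inv: "inv_into (U1 \<times> U) \<Phi> (vec_pair (\<phi>1 a) z') = (a, inv_into U \<phi> z')"
    if "z' \<in> \<phi> ` U" for z'
  proof (rule inv_into_f_eq)
    show "inj_on \<Phi> (U1 \<times> U)"
      using chart(3)[OF c] chart(3)[OF c1(1)] unfolding \<Phi>_def inj_on_def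
      by (auto simp: vec_pair_eq_iff)
    show "(a, inv_into U \<phi> z') \<in> U1 \<times> U" using that c1(2) by (auto intro: inv_into_into)
    show "\<Phi> (a, inv_into U \<phi> z') = vec_pair (\<phi>1 a) z'"
      unfolding \<Phi>_def using that by (simp add: f_inv_into_f)
  qed
  obtain B where B: "open B" "\<phi> ` U = model M \<inter> B"
    using chart(5)[OF c openin_topspace] chart(2)[OF c] topspace_eq
    by (auto simp: Int_absorb2 openin_open)
  have zU: "z \<in> \<phi> ` U" using y by auto
  have ev: "\<forall>\<^sub>F x' in at z within model M.
      \<psi> ((\<lambda>(x, y). x \<otimes>\<^bsub>G\<^esub> y) (inv_into (U1 \<times> U) \<Phi> (vec_pair (\<phi>1 a) x'))) $ i =
      \<psi> (a \<otimes>\<^bsub>G\<^esub> inv_into U \<phi> x') $ i"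
    unfolding eventually_at_topological using B zU inv by (intro exI[of _ B]) auto
  have "((\<lambda>z. \<psi> (a \<otimes>\<^bsub>G\<^esub> inv_into U \<phi> z) $ i) has_derivative (\<lambda>w. D (vec_pair 0 w))) (at z within model M)"
    by (rule has_derivative_transform_eventually[OF D' ev]) (use B zU inv[OF zU] in auto)
  then show "\<exists>D. ((\<lambda>z. \<psi> (a \<otimes>\<^bsub>G\<^esub> inv_into U \<phi> z) $ i) has_derivative D) (at z within model M) \<and>
      (\<forall>c w. D (c *s w) = c * D w)"
    using Ds by (auto simp: vec_pair_smult intro!: exI[of _ "\<lambda>w. D (vec_pair 0 w)"])
qed

lemma openin_left_translation:
  assumes "a \<in> carrier G" "openin (mtop M) W"
  shows "openin (mtop M) {y \<in> carrier G. a \<otimes>\<^bsub>G\<^esub> y \<in> W}"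
  using openin_continuous_map_preimage[OF continuous_left_translation[OF assms(1)] assms(2)]
  by (simp add: topspace_eq)

text \<open>Chain rule for \<open>f\<close> after the translation, read in a chart at \<open>a y\<close>.  The chart maps can be cancelled
  only near \<open>z\<close>; hence derivatives are first taken within the relatively open set \<open>S\<close>, where they agree
  with derivatives within the model space.\<close>

lemma holo_fun_on_left_translation:
  assumes a: "a \<in> carrier G" and f: "holo_fun_on M W f"
  shows "holo_fun_on M {y \<in> carrier G. a \<otimes>\<^bsub>G\<^esub> y \<in> W} (\<lambda>y. f (a \<otimes>\<^bsub>G\<^esub> y))"
proof -
  have W: "openin (mtop M) W" using f unfolding holo_fun_on_def by simp
  have "cholo_on (model M) (\<phi> ` (U \<inter> {y \<in> carrier G. a \<otimes>\<^bsub>G\<^esub> y \<in> W})) (\<lambda>z. f (a \<otimes>\<^bsub>G\<^esub> inv_into U \<phi> z))"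
    if c: "(U, \<phi>) \<in> charts M" for U \<phi>
    unfolding cholo_on_def
  proof
    fix z assume "z \<in> \<phi> ` (U \<inter> {y \<in> carrier G. a \<otimes>\<^bsub>G\<^esub> y \<in> W})"
    then obtain y where y: "y \<in> U" "y \<in> carrier G" "a \<otimes>\<^bsub>G\<^esub> y \<in> W" "z = \<phi> y" by blast
    obtain P \<psi> where d: "(P, \<psi>) \<in> charts M" "a \<otimes>\<^bsub>G\<^esub> y \<in> P"
      using chart_around[of "a \<otimes>\<^bsub>G\<^esub> y"] a y by blast
    define S where "S = \<phi> ` (U \<inter> {y \<in> carrier G. a \<otimes>\<^bsub>G\<^esub> y \<in> P})"
    define T where "T z = \<psi> (a \<otimes>\<^bsub>G\<^esub> inv_into U \<phi> z)" for z
    have "openin (top_of_set (model M)) S"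
      unfolding S_def using chart(5)[OF c openin_left_translation[OF a chart(1)[OF d(1)]]] .
    then obtain B where B: "open B" "S = model M \<inter> B" by (auto simp: openin_open)
    have zS: "z \<in> S" unfolding S_def using y d by auto
    have "\<exists>D. ((\<lambda>z. T z $ i) has_derivative D) (at z within model M) \<and> (\<forall>c w. D (c *s w) = c * D w)"
      for i
      using cholo_left_translation[OF a c d(1), of i] y d(2) unfolding cholo_on_def T_def by blast
    then obtain D where D: "\<And>i. ((\<lambda>z. T z $ i) has_derivative D i) (at z within model M)"
      and Ds: "\<And>i c w. D i (c *s w) = c * D i w" by metis
    have DT: "(T has_derivative (\<lambda>w. \<chi> i. D i w)) (at z within S)"
      by (rule has_derivative_subset[OF has_derivative_vec[OF D]]) (simp add: B)
    \<comment> \<open>on \<open>S\<close> the translate stays in the chart \<open>P\<close>, so \<open>\<psi>\<close> can be inverted\<close>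
    have TS: "inv_into P \<psi> (T z') = a \<otimes>\<^bsub>G\<^esub> inv_into U \<phi> z' \<and> T z' \<in> \<psi> ` P" if "z' \<in> S" for z'
    proof -
      have "a \<otimes>\<^bsub>G\<^esub> inv_into U \<phi> z' \<in> P"
        using that chart(3)[OF c] unfolding S_def by (auto simp: inv_into_f_f)
      then show ?thesis unfolding T_def using chart(3)[OF d(1)] by (auto simp: inv_into_f_f)
    qed
    have "T z \<in> \<psi> ` (P \<inter> W)"
      unfolding T_def using y d chart(3)[OF c] by (auto simp: inv_into_f_f)
    moreover have "cholo_on (model M) (\<psi> ` (P \<inter> W)) (\<lambda>z. f (inv_into P \<psi> z))"
      using f d unfolding holo_fun_on_def by blast
    ultimately obtain E where
      E: "((\<lambda>z. f (inv_into P \<psi> z)) has_derivative E) (at (T z) within model M)"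
      and Es: "\<And>c w. E (c *s w) = c * E w"
      unfolding cholo_on_def by blast
    have "T ` S \<subseteq> model M" using TS chart(4)[OF d(1)] by blast
    from has_derivative_in_compose[OF DT has_derivative_subset[OF E this]]
    have "((\<lambda>z. f (inv_into P \<psi> (T z))) has_derivative (\<lambda>w. E (\<chi> i. D i w))) (at z within S)" .
    then have "((\<lambda>z. f (a \<otimes>\<^bsub>G\<^esub> inv_into U \<phi> z)) has_derivative (\<lambda>w. E (\<chi> i. D i w))) (at z within S)"
      by (rule has_derivative_transform[rotated 2]) (use zS TS in auto)
    moreover have "at z within S = at z within model M"
      using B zS by (intro at_within_nhd[of _ B]) auto
    moreover have "E (\<chi> i. D i (c *s w)) = c * E (\<chi> i. D i w)" for c w
    proof -
      have "(\<chi> i. D i (c *s w)) = c *s (\<chi> i. D i w)" by (simp add: Ds vec_eq_iff)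
      then show ?thesis by (simp add: Es)
    qed
    ultimately show "\<exists>D. ((\<lambda>z. f (a \<otimes>\<^bsub>G\<^esub> inv_into U \<phi> z)) has_derivative D) (at z within model M) \<and>
        (\<forall>c w. D (c *s w) = c * D w)" by auto
  qed
  then show ?thesis
    using openin_left_translation[OF a W] unfolding holo_fun_on_def by auto
qed

lemma holo_at_left_translation:
  assumes "a \<in> carrier G" "x \<in> carrier G" "holo_at M (a \<otimes>\<^bsub>G\<^esub> x) f"
  shows "holo_at M x (\<lambda>y. f (a \<otimes>\<^bsub>G\<^esub> y))"
proof -
  obtain W where "a \<otimes>\<^bsub>G\<^esub> x \<in> W" "holo_fun_on M W f"
    using assms(3) unfolding holo_at_def by auto
  then show ?thesis
    using holo_fun_on_left_translation[OF assms(1)] assms(2) unfolding holo_at_def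
    by (intro exI[of _ "{y \<in> carrier G. a \<otimes>\<^bsub>G\<^esub> y \<in> W}"]) simp
qed

lemma eventually_left_translation:
  assumes "a \<in> carrier G" "x \<in> carrier G" "\<forall>\<^sub>F y in nhdsin (mtop M) (a \<otimes>\<^bsub>G\<^esub> x). P y"
  shows "\<forall>\<^sub>F y in nhdsin (mtop M) x. P (a \<otimes>\<^bsub>G\<^esub> y)"
proof -
  obtain W where "openin (mtop M) W" "a \<otimes>\<^bsub>G\<^esub> x \<in> W" "\<forall>y\<in>W. P y"
    using assms by (auto simp: eventually_nhdsin topspace_eq)
  then show ?thesis
    using assms openin_left_translation[of a W] unfolding eventually_nhdsin
    by (intro disjI2 exI[of _ "{y \<in> carrier G. a \<otimes>\<^bsub>G\<^esub> y \<in> W}"]) auto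
qed

lemma eventually_in_group: "\<forall>\<^sub>F y in nhdsin (mtop M) x. y \<in> carrier G"
  using openin_topspace[of "mtop M"] unfolding eventually_nhdsin topspace_eq by blast

text \<open>A relation \<open>g (h \<circ> a) = 0\<close> near \<open>x\<close> translates back to \<open>(g \<circ> a\<inverse>) h = 0\<close> near \<open>a x\<close>.\<close>

lemma denom_at_left_translation:
  assumes a: "a \<in> carrier G" and x: "x \<in> carrier G" and h: "denom_at M (a \<otimes>\<^bsub>G\<^esub> x) h"
  shows "denom_at M x (\<lambda>y. h (a \<otimes>\<^bsub>G\<^esub> y))"
  unfolding denom_at_def
proof (intro conjI allI impI)
  show "holo_at M x (\<lambda>y. h (a \<otimes>\<^bsub>G\<^esub> y))"
    by (rule holo_at_left_translation[OF a x denom_at_holo[OF h]])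
  fix g assume g: "holo_at M x g \<and> (\<forall>\<^sub>F y in nhdsin (mtop M) x. g y * h (a \<otimes>\<^bsub>G\<^esub> y) = 0)"
  have ia: "inv\<^bsub>G\<^esub> a \<in> carrier G" and ax: "a \<otimes>\<^bsub>G\<^esub> x \<in> carrier G" and x_eq: "inv\<^bsub>G\<^esub> a \<otimes>\<^bsub>G\<^esub> (a \<otimes>\<^bsub>G\<^esub> x) = x"
    using a x by (auto simp: m_assoc[symmetric])
  have "\<forall>\<^sub>F y in nhdsin (mtop M) (a \<otimes>\<^bsub>G\<^esub> x). g (inv\<^bsub>G\<^esub> a \<otimes>\<^bsub>G\<^esub> y) * h (a \<otimes>\<^bsub>G\<^esub> (inv\<^bsub>G\<^esub> a \<otimes>\<^bsub>G\<^esub> y)) = 0"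
    by (rule eventually_left_translation[OF ia ax]) (use g x_eq in simp)
  then have "\<forall>\<^sub>F y in nhdsin (mtop M) (a \<otimes>\<^bsub>G\<^esub> x). g (inv\<^bsub>G\<^esub> a \<otimes>\<^bsub>G\<^esub> y) * h y = 0"
    using eventually_in_group by (rule eventually_elim2) (use a in \<open>simp add: m_assoc[symmetric]\<close>)
  moreover have "holo_at M (a \<otimes>\<^bsub>G\<^esub> x) (\<lambda>y. g (inv\<^bsub>G\<^esub> a \<otimes>\<^bsub>G\<^esub> y))"
    by (rule holo_at_left_translation[OF ia ax]) (use g x_eq in simp)
  ultimately have "\<forall>\<^sub>F y in nhdsin (mtop M) (a \<otimes>\<^bsub>G\<^esub> x). g (inv\<^bsub>G\<^esub> a \<otimes>\<^bsub>G\<^esub> y) = 0"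
    using h unfolding denom_at_def by blast
  then have "\<forall>\<^sub>F y in nhdsin (mtop M) x. g (inv\<^bsub>G\<^esub> a \<otimes>\<^bsub>G\<^esub> (a \<otimes>\<^bsub>G\<^esub> y)) = 0"
    by (rule eventually_left_translation[OF a x])
  then show "\<forall>\<^sub>F y in nhdsin (mtop M) x. g y = 0"
    using eventually_in_group by (rule eventually_elim2) (use a in \<open>simp add: m_assoc[symmetric]\<close>)
qed

text \<open>Although the germ is holomorphic, its class contains fractions with arbitrary denominators; their
  translates must be fractions again, which is where \<open>denom_at_left_translation\<close> enters.\<close>

lemma translate_holo_germ:
  assumes a: "a \<in> carrier G" and x: "x \<in> carrier G" and f: "holo_at M x f"
  shows "translate_germ G M a x (holo_germ M x f) =
    holo_germ M (a \<otimes>\<^bsub>G\<^esub> x) (\<lambda>y. f (inv\<^bsub>G\<^esub> a \<otimes>\<^bsub>G\<^esub> y))"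
proof -
  have ia: "inv\<^bsub>G\<^esub> a \<in> carrier G" and ax: "a \<otimes>\<^bsub>G\<^esub> x \<in> carrier G" and x_eq: "inv\<^bsub>G\<^esub> a \<otimes>\<^bsub>G\<^esub> (a \<otimes>\<^bsub>G\<^esub> x) = x"
    using a x by (auto simp: m_assoc[symmetric])
  have "quot_germ M (a \<otimes>\<^bsub>G\<^esub> x) (\<lambda>y. g (inv\<^bsub>G\<^esub> a \<otimes>\<^bsub>G\<^esub> y)) (\<lambda>y. h (inv\<^bsub>G\<^esub> a \<otimes>\<^bsub>G\<^esub> y)) =
      holo_germ M (a \<otimes>\<^bsub>G\<^esub> x) (\<lambda>y. f (inv\<^bsub>G\<^esub> a \<otimes>\<^bsub>G\<^esub> y))"
    if "(g, h) \<in> holo_germ M x f" for g h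
  proof (subst quot_germ_eq_iff)
    note gh = mem_quot_germ[OF that]
    show "\<forall>\<^sub>F y in nhdsin (mtop M) (a \<otimes>\<^bsub>G\<^esub> x).
        g (inv\<^bsub>G\<^esub> a \<otimes>\<^bsub>G\<^esub> y) * 1 = f (inv\<^bsub>G\<^esub> a \<otimes>\<^bsub>G\<^esub> y) * h (inv\<^bsub>G\<^esub> a \<otimes>\<^bsub>G\<^esub> y)"
      using eventually_left_translation[OF ia ax, of "\<lambda>y. g y * 1 = f y * h y"] gh(5) x_eq
      by (simp add: eq_commute)
    show "holo_at M (a \<otimes>\<^bsub>G\<^esub> x) (\<lambda>y. g (inv\<^bsub>G\<^esub> a \<otimes>\<^bsub>G\<^esub> y))" "holo_at M (a \<otimes>\<^bsub>G\<^esub> x) (\<lambda>y. f (inv\<^bsub>G\<^esub> a \<otimes>\<^bsub>G\<^esub> y))"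
      by (rule holo_at_left_translation[OF ia ax], use gh f x_eq in simp)+
    show "denom_at M (a \<otimes>\<^bsub>G\<^esub> x) (\<lambda>y. h (inv\<^bsub>G\<^esub> a \<otimes>\<^bsub>G\<^esub> y))"
      by (rule denom_at_left_translation[OF ia ax]) (use gh x_eq in simp)
    show "denom_at M (a \<otimes>\<^bsub>G\<^esub> x) (\<lambda>_. 1)" using ax topspace_eq by auto
  qed
  moreover have "(f, \<lambda>_. 1) \<in> holo_germ M x f"
    using f x topspace_eq by (intro quot_germ_self) auto
  ultimately show ?thesis
    unfolding translate_germ_def by (intro UN_const) auto
qed

end

section \<open>Sums in the skew group ring\<close>

lemma mero_ring_sel [simp]:
  "carrier (mero_ring M) = mero_functions M"
  "zero (mero_ring M) = (\<lambda>x\<in>topspace (mtop M). \<zero>\<^bsub>mero_stalk M x\<^esub>)"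
  "add (mero_ring M) s t = (\<lambda>x\<in>topspace (mtop M). s x \<oplus>\<^bsub>mero_stalk M x\<^esub> t x)"
  unfolding mero_ring_def by simp_all

lemma mero_functions_PiE:
  "s \<in> mero_functions M \<Longrightarrow> s \<in> (\<Pi>\<^sub>E x\<in>topspace (mtop M). carrier (mero_stalk M x))"
  unfolding mero_functions_def by simp

lemma mero_functions_stalk:
  "s \<in> mero_functions M \<Longrightarrow> x \<in> topspace (mtop M) \<Longrightarrow> s x \<in> carrier (mero_stalk M x)"
  by (drule mero_functions_PiE) (rule PiE_mem)

lemma mero_functions_local:
  assumes "s \<in> mero_functions M" "x \<in> topspace (mtop M)"
  obtains W g h where "x \<in> W" "holo_fun_on M W g" "holo_fun_on M W h"
    "\<And>y. y \<in> W \<Longrightarrow> denom_at M y h" "\<And>y. y \<in> W \<Longrightarrow> s y = quot_germ M y g h"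
proof -
  have "\<exists>W g h. x \<in> W \<and> holo_fun_on M W g \<and> holo_fun_on M W h \<and>
      (\<forall>y\<in>W. denom_at M y h \<and> s y = quot_germ M y g h)"
    using assms unfolding mero_functions_def by simp
  then show thesis using that by (elim exE conjE) simp
qed

lemma mero_functions_zero:
  "(\<lambda>x\<in>topspace (mtop M). \<zero>\<^bsub>mero_stalk M x\<^esub>) \<in> mero_functions M"
  unfolding mero_functions_def
proof (intro CollectI conjI ballI)
  show "(\<lambda>x\<in>topspace (mtop M). \<zero>\<^bsub>mero_stalk M x\<^esub>)
      \<in> (\<Pi>\<^sub>E x\<in>topspace (mtop M). carrier (mero_stalk M x))"
    by (simp add: mero_stalk_zero germ_ops)
  fix x assume x: "x \<in> topspace (mtop M)"
  show "\<exists>W g h. x \<in> W \<and> holo_fun_on M W g \<and> holo_fun_on M W h \<and>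
      (\<forall>y\<in>W. denom_at M y h \<and>
        (\<lambda>x\<in>topspace (mtop M). \<zero>\<^bsub>mero_stalk M x\<^esub>) y = quot_germ M y g h)"
    by (rule exI[of _ "topspace (mtop M)"], rule exI[of _ "\<lambda>_. 0"], rule exI[of _ "\<lambda>_. 1"])
       (simp add: x holo_fun_on_const mero_stalk_zero)
qed

text \<open>Local representations of the summands over \<open>W\<close> and \<open>W'\<close> combine over the intersection, with the
  product of the denominators.\<close>

lemma mero_functions_add:
  assumes s: "s \<in> mero_functions M" and t: "t \<in> mero_functions M"
  shows "(\<lambda>x\<in>topspace (mtop M). s x \<oplus>\<^bsub>mero_stalk M x\<^esub> t x) \<in> mero_functions M"
  unfolding mero_functions_def
proof (intro CollectI conjI ballI)
  show "(\<lambda>x\<in>topspace (mtop M). s x \<oplus>\<^bsub>mero_stalk M x\<^esub> t x)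
      \<in> (\<Pi>\<^sub>E x\<in>topspace (mtop M). carrier (mero_stalk M x))"
  proof (rule restrict_PiE_iff[THEN iffD2], rule ballI)
    fix x assume x: "x \<in> topspace (mtop M)"
    then interpret cring "mero_stalk M x" by (rule mero_stalk_cring)
    show "s x \<oplus>\<^bsub>mero_stalk M x\<^esub> t x \<in> carrier (mero_stalk M x)"
      using mero_functions_stalk[OF s x] mero_functions_stalk[OF t x] by simp
  qed
  fix x assume x: "x \<in> topspace (mtop M)"
  obtain W g h where W: "x \<in> W" "holo_fun_on M W g" "holo_fun_on M W h"
    "\<And>y. y \<in> W \<Longrightarrow> denom_at M y h" "\<And>y. y \<in> W \<Longrightarrow> s y = quot_germ M y g h"
    by (rule mero_functions_local[OF s x]) blast
  obtain W' g' h' where W': "x \<in> W'" "holo_fun_on M W' g'" "holo_fun_on M W' h'"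
    "\<And>y. y \<in> W' \<Longrightarrow> denom_at M y h'" "\<And>y. y \<in> W' \<Longrightarrow> t y = quot_germ M y g' h'"
    by (rule mero_functions_local[OF t x]) blast
  have "(\<lambda>x\<in>topspace (mtop M). s x \<oplus>\<^bsub>mero_stalk M x\<^esub> t x) y =
      quot_germ M y (\<lambda>z. g z * h' z + g' z * h z) (\<lambda>z. h z * h' z)" if y: "y \<in> W \<inter> W'" for y
  proof -
    have "holo_at M y g" "holo_at M y g'"
      unfolding holo_at_def using y W(2) W'(2) by blast+
    moreover have "y \<in> topspace (mtop M)"
      using calculation(1) by (rule holo_at_topspace)
    ultimately show ?thesis using y W(4,5) W'(4,5) by (simp add: quot_germ_add)
  qed
  moreover have "denom_at M y (\<lambda>z. h z * h' z)" if "y \<in> W \<inter> W'" for y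
    using that W(4) W'(4) by (simp add: denom_at_mult)
  moreover have "holo_fun_on M (W \<inter> W') (\<lambda>z. g z * h' z + g' z * h z)"
    using holo_fun_on_Int[OF W(2) W'(3)] holo_fun_on_Int[OF W(3) W'(2)]
    by (simp add: holo_fun_on_add holo_fun_on_mult)
  moreover have "holo_fun_on M (W \<inter> W') (\<lambda>z. h z * h' z)"
    using holo_fun_on_Int[OF W(3) W'(3)] by (simp add: holo_fun_on_mult)
  ultimately show "\<exists>W g h. x \<in> W \<and> holo_fun_on M W g \<and> holo_fun_on M W h \<and>
      (\<forall>y\<in>W. denom_at M y h \<and>
        (\<lambda>x\<in>topspace (mtop M). s x \<oplus>\<^bsub>mero_stalk M x\<^esub> t x) y = quot_germ M y g h)"
    using W(1) W'(1)
    by (intro exI[of _ "W \<inter> W'"] exI[of _ "\<lambda>z. g z * h' z + g' z * h z"] exI[of _ "\<lambda>z. h z * h' z"]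
        conjI ballI) simp_all
qed

lemma mero_ring_abelian_monoid: "abelian_monoid (mero_ring M)"
proof (rule abelian_monoidI)
  fix s assume s: "s \<in> carrier (mero_ring M)"
  have sx: "s x \<in> carrier (mero_stalk M x)" if "x \<in> topspace (mtop M)" for x
    using s that by (simp add: mero_functions_stalk)
  show "\<zero>\<^bsub>mero_ring M\<^esub> \<oplus>\<^bsub>mero_ring M\<^esub> s = s"
  proof (rule PiE_ext)
    show "\<zero>\<^bsub>mero_ring M\<^esub> \<oplus>\<^bsub>mero_ring M\<^esub> s \<in> (\<Pi>\<^sub>E x\<in>topspace (mtop M). carrier (mero_stalk M x))"
      using s by (intro mero_functions_PiE) (simp only: mero_ring_sel mero_functions_add mero_functions_zero)
    show "s \<in> (\<Pi>\<^sub>E x\<in>topspace (mtop M). carrier (mero_stalk M x))"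
      using s by (simp add: mero_functions_PiE)
    fix x assume x: "x \<in> topspace (mtop M)"
    interpret cring "mero_stalk M x" using x by (rule mero_stalk_cring)
    show "(\<zero>\<^bsub>mero_ring M\<^esub> \<oplus>\<^bsub>mero_ring M\<^esub> s) x = s x" using x sx by simp
  qed
  fix t assume t: "t \<in> carrier (mero_ring M)"
  have tx: "t x \<in> carrier (mero_stalk M x)" if "x \<in> topspace (mtop M)" for x
    using t that by (simp add: mero_functions_stalk)
  show "s \<oplus>\<^bsub>mero_ring M\<^esub> t \<in> carrier (mero_ring M)"
    using s t by (simp add: mero_functions_add)
  show "s \<oplus>\<^bsub>mero_ring M\<^esub> t = t \<oplus>\<^bsub>mero_ring M\<^esub> s"
    unfolding mero_ring_sel
  proof (rule restrict_ext)
    fix x assume x: "x \<in> topspace (mtop M)"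
    interpret cring "mero_stalk M x" using x by (rule mero_stalk_cring)
    show "s x \<oplus>\<^bsub>mero_stalk M x\<^esub> t x = t x \<oplus>\<^bsub>mero_stalk M x\<^esub> s x"
      using sx tx x by (simp add: add.m_comm)
  qed
  fix u assume u: "u \<in> carrier (mero_ring M)"
  have ux: "u x \<in> carrier (mero_stalk M x)" if "x \<in> topspace (mtop M)" for x
    using u that by (simp add: mero_functions_stalk)
  show "s \<oplus>\<^bsub>mero_ring M\<^esub> t \<oplus>\<^bsub>mero_ring M\<^esub> u = s \<oplus>\<^bsub>mero_ring M\<^esub> (t \<oplus>\<^bsub>mero_ring M\<^esub> u)"
    unfolding mero_ring_sel
  proof (rule restrict_ext)
    fix x assume x: "x \<in> topspace (mtop M)"
    interpret cring "mero_stalk M x" using x by (rule mero_stalk_cring)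
    show "(\<lambda>x\<in>topspace (mtop M). s x \<oplus>\<^bsub>mero_stalk M x\<^esub> t x) x \<oplus>\<^bsub>mero_stalk M x\<^esub> u x =
        s x \<oplus>\<^bsub>mero_stalk M x\<^esub> (\<lambda>x\<in>topspace (mtop M). t x \<oplus>\<^bsub>mero_stalk M x\<^esub> u x) x"
      using sx tx ux x by (simp add: add.m_assoc)
  qed
next
  show "\<zero>\<^bsub>mero_ring M\<^esub> \<in> carrier (mero_ring M)"
    by (simp add: mero_functions_zero)
qed

lemma skew_ring_carrier_iff: "A \<in> carrier (skew_ring G M) \<longleftrightarrow>
    A \<in> carrier G \<rightarrow>\<^sub>E mero_functions M \<and> finite (skew_supp G M A)"
  unfolding skew_ring_def by simp

lemma skew_ring_sel:
  "zero (skew_ring G M) = (\<lambda>\<zeta>\<in>carrier G. \<zero>\<^bsub>mero_ring M\<^esub>)"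
  "add (skew_ring G M) A B = (\<lambda>\<zeta>\<in>carrier G. A \<zeta> \<oplus>\<^bsub>mero_ring M\<^esub> B \<zeta>)"
  unfolding skew_ring_def by simp_all

lemma skew_ring_abelian_monoid: "abelian_monoid (skew_ring G M)"
proof -
  interpret R: abelian_monoid "mero_ring M" by (rule mero_ring_abelian_monoid)
  have c: "A \<in> extensional (carrier G)" "\<And>\<zeta>. \<zeta> \<in> carrier G \<Longrightarrow> A \<zeta> \<in> carrier (mero_ring M)"
    "finite (skew_supp G M A)"
    if "A \<in> carrier (skew_ring G M)" for A
    using that unfolding skew_ring_carrier_iff PiE_iff by simp_all
  show ?thesis
  proof (rule abelian_monoidI)
    show "\<zero>\<^bsub>skew_ring G M\<^esub> \<in> carrier (skew_ring G M)"
      using R.zero_closed by (simp add: skew_ring_carrier_iff skew_ring_sel skew_supp_def)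
    fix A assume A: "A \<in> carrier (skew_ring G M)"
    show "\<zero>\<^bsub>skew_ring G M\<^esub> \<oplus>\<^bsub>skew_ring G M\<^esub> A = A"
      unfolding skew_ring_sel
      by (rule extensionalityI[OF restrict_extensional c(1)[OF A]])
         (simp add: R.l_zero[OF c(2)[OF A]] del: mero_ring_sel)
    fix B assume B: "B \<in> carrier (skew_ring G M)"
    have "skew_supp G M (A \<oplus>\<^bsub>skew_ring G M\<^esub> B) \<subseteq> skew_supp G M A \<union> skew_supp G M B"
      unfolding skew_supp_def skew_ring_sel
      by (auto simp del: mero_ring_sel) 
    then have "finite (skew_supp G M (A \<oplus>\<^bsub>skew_ring G M\<^esub> B))"
      using c(3)[OF A] c(3)[OF B] by (metis finite_Un finite_subset)
    moreover have "A \<oplus>\<^bsub>skew_ring G M\<^esub> B \<in> carrier G \<rightarrow>\<^sub>E carrier (mero_ring M)"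
      unfolding skew_ring_sel
      using R.a_closed[OF c(2)[OF A] c(2)[OF B]] by (simp del: mero_ring_sel)
    ultimately show "A \<oplus>\<^bsub>skew_ring G M\<^esub> B \<in> carrier (skew_ring G M)"
      by (simp add: skew_ring_carrier_iff)
    show "A \<oplus>\<^bsub>skew_ring G M\<^esub> B = B \<oplus>\<^bsub>skew_ring G M\<^esub> A"
      unfolding skew_ring_sel
      by (rule restrict_ext) (simp add: R.a_comm[OF c(2)[OF A] c(2)[OF B]] del: mero_ring_sel)
    fix C assume C: "C \<in> carrier (skew_ring G M)"
    show "A \<oplus>\<^bsub>skew_ring G M\<^esub> B \<oplus>\<^bsub>skew_ring G M\<^esub> C = A \<oplus>\<^bsub>skew_ring G M\<^esub> (B \<oplus>\<^bsub>skew_ring G M\<^esub> C)"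
      unfolding skew_ring_sel
      by (rule restrict_ext)
         (simp add: R.a_assoc[OF c(2)[OF A] c(2)[OF B] c(2)[OF C]] del: mero_ring_sel)
  qed
qed

lemma skew_term_closed:
  assumes "f \<in> mero_functions M"
  shows "skew_term G M f \<xi> \<in> carrier (skew_ring G M)"
proof -
  interpret R: abelian_monoid "mero_ring M" by (rule mero_ring_abelian_monoid)
  have "skew_supp G M (skew_term G M f \<xi>) \<subseteq> {\<xi>}"
    unfolding skew_supp_def skew_term_def by auto
  then show ?thesis
    using assms R.zero_closed finite_subset[of _ "{\<xi>}"]
    unfolding skew_ring_carrier_iff by (simp add: skew_term_def)
qed

text \<open>As \<open>\<xi>\<close> is injective, no two terms of the sum are collected into one coefficient.\<close>

lemma skew_sum_coeffs:
  assumes "finite J" "inj_on \<xi> J" "\<And>j. j \<in> J \<Longrightarrow> f j \<in> mero_functions M"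
    "\<And>j. j \<in> J \<Longrightarrow> \<xi> j \<in> carrier G"
  defines "A \<equiv> (\<Oplus>\<^bsub>skew_ring G M\<^esub>j\<in>J. skew_term G M (f j) (\<xi> j))"
  shows "A \<in> carrier (skew_ring G M)" "\<And>j. j \<in> J \<Longrightarrow> A (\<xi> j) = f j" "skew_supp G M A \<subseteq> \<xi> ` J"
proof -
  interpret R: abelian_monoid "mero_ring M" by (rule mero_ring_abelian_monoid)
  interpret S: abelian_monoid "skew_ring G M" by (rule skew_ring_abelian_monoid)
  have "A \<in> carrier (skew_ring G M) \<and> (\<forall>j\<in>J. A (\<xi> j) = f j) \<and>
    (\<forall>\<zeta>\<in>carrier G - \<xi> ` J. A \<zeta> = \<zero>\<^bsub>mero_ring M\<^esub>)"
    unfolding A_def using assms(1-4)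
  proof (induct J)
    case empty
    show ?case unfolding S.finsum_empty
      by (intro conjI S.zero_closed) (simp_all add: skew_ring_sel(1) del: mero_ring_sel)
  next
    case (insert j J)
    define A where "A = (\<Oplus>\<^bsub>skew_ring G M\<^esub>j\<in>J. skew_term G M (f j) (\<xi> j))"
    have IH: "A \<in> carrier (skew_ring G M)" "\<And>j. j\<in>J \<Longrightarrow> A (\<xi> j) = f j"
      "\<And>\<zeta>. \<zeta>\<in>carrier G \<Longrightarrow> \<zeta> \<notin> \<xi> ` J \<Longrightarrow> A \<zeta> = \<zero>\<^bsub>mero_ring M\<^esub>"
      unfolding A_def using insert by (simp_all del: mero_ring_sel)
    have sum: "(\<Oplus>\<^bsub>skew_ring G M\<^esub>j\<in>insert j J. skew_term G M (f j) (\<xi> j)) =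
        skew_term G M (f j) (\<xi> j) \<oplus>\<^bsub>skew_ring G M\<^esub> A"
      unfolding A_def using insert by (simp add: skew_term_closed)
    have fj: "f k \<in> carrier (mero_ring M)" if "k \<in> insert j J" for k
      using insert that by simp
    have j: "\<xi> j \<notin> \<xi> ` J" using insert by auto
    have "skew_term G M (f j) (\<xi> j) \<oplus>\<^bsub>skew_ring G M\<^esub> A \<in> carrier (skew_ring G M)"
      using IH(1) fj by (simp add: skew_term_closed)
    moreover have "(skew_term G M (f j) (\<xi> j) \<oplus>\<^bsub>skew_ring G M\<^esub> A) (\<xi> k) = f k"
      if k: "k \<in> insert j J" for k
    proof (cases "k = j")
      case True
      then show ?thesis using j IH(3) insert fj
        by (simp add: skew_ring_sel skew_term_def del: mero_ring_sel)
    next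
      case False
      then have "\<xi> k \<noteq> \<xi> j" using k j by (metis imageI insertE)
      then show ?thesis using False k IH(2) insert fj
        by (simp add: skew_ring_sel skew_term_def del: mero_ring_sel)
    qed
    moreover have "(skew_term G M (f j) (\<xi> j) \<oplus>\<^bsub>skew_ring G M\<^esub> A) \<zeta> = \<zero>\<^bsub>mero_ring M\<^esub>"
      if "\<zeta> \<in> carrier G - \<xi> ` insert j J" for \<zeta>
      using that IH(3) by (simp add: skew_ring_sel skew_term_def del: mero_ring_sel)
    ultimately show ?case unfolding sum by blast
  qed
  then show "A \<in> carrier (skew_ring G M)" "\<And>j. j \<in> J \<Longrightarrow> A (\<xi> j) = f j" "skew_supp G M A \<subseteq> \<xi> ` J"
    unfolding skew_supp_def by auto
qed

section \<open>The module of points as a space of functions\<close>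

text \<open>The element of the module of points with the value \<open>u x\<close> at each \<open>x \<in> S\<close>, represented by constant
  germs.\<close>

definition point_vec ::
    "('v, 'n::finite) cmanifold \<Rightarrow> 'v set \<Rightarrow> ('v \<Rightarrow> complex) \<Rightarrow> 'v \<Rightarrow> 'v fraction set set"
  where "point_vec M S u =
    (\<lambda>x\<in>S. max_ideal M x +>\<^bsub>holo_stalk M x\<^esub> holo_germ M x (\<lambda>_. u x))"

lemma mem_holo_stalk: "holo_at M x f \<Longrightarrow> holo_germ M x f \<in> carrier (holo_stalk M x)"
  unfolding carrier_holo_stalk by auto

lemma holo_stalkE:
  assumes "a \<in> carrier (holo_stalk M x)"
  obtains f where "holo_at M x f" "a = holo_germ M x f"
  using assms unfolding carrier_holo_stalk by auto

lemma coset_zero: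
  assumes x: "x \<in> topspace (mtop M)"
  shows "max_ideal M x +>\<^bsub>holo_stalk M x\<^esub> holo_germ M x (\<lambda>_. 0) = max_ideal M x"
proof -
  interpret ring "holo_stalk M x" using x by (rule holo_stalk_ring)
  interpret ideal "max_ideal M x" "holo_stalk M x" using x by (rule max_ideal_is_ideal)
  show ?thesis using a_coset_add_zero[OF a_subset] by (simp add: mero_stalk_zero)
qed

lemma residue_group: 
  assumes x: "x \<in> topspace (mtop M)"
  shows "group (add_monoid (holo_stalk M x Quot max_ideal M x))"
proof -
  interpret ideal "max_ideal M x" "holo_stalk M x" using x by (rule max_ideal_is_ideal)
  interpret Q: ring "holo_stalk M x Quot max_ideal M x" by (rule quotient_is_ring)
  show ?thesis by (rule Q.a_group)
qed

lemma carrier_residue: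
  "carrier (holo_stalk M x Quot max_ideal M x) =
    {max_ideal M x +>\<^bsub>holo_stalk M x\<^esub> a | a. a \<in> carrier (holo_stalk M x)}"
  unfolding FactRing_def A_RCOSETS_def' by auto

lemma zero_residue: "zero (holo_stalk M x Quot max_ideal M x) = max_ideal M x"
  unfolding FactRing_def by simp

lemma coset_add:
  assumes x: "x \<in> topspace (mtop M)"
  shows "(max_ideal M x +>\<^bsub>holo_stalk M x\<^esub> holo_germ M x (\<lambda>_. c))
    \<oplus>\<^bsub>holo_stalk M x Quot max_ideal M x\<^esub> (max_ideal M x +>\<^bsub>holo_stalk M x\<^esub> holo_germ M x (\<lambda>_. d)) =
    max_ideal M x +>\<^bsub>holo_stalk M x\<^esub> holo_germ M x (\<lambda>_. c + d)"
proof -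
  interpret ideal "max_ideal M x" "holo_stalk M x" using x by (rule max_ideal_is_ideal)
  show ?thesis
    unfolding FactRing_def using x by (simp add: a_rcos_sum mem_holo_stalk holo_germ_add)
qed

context
  fixes M :: "('v, 'n::finite) cmanifold" and S :: "'v set"
  assumes S: "S \<subseteq> topspace (mtop M)"
begin

lemma point_vec_eq_iff: "point_vec M S u = point_vec M S w \<longleftrightarrow> (\<forall>x\<in>S. u x = w x)"
proof -
  have "point_vec M S u x = point_vec M S w x \<longleftrightarrow> u x = w x" if "x \<in> S" for x
    using that S max_ideal_coset_eq_iff[of M x "\<lambda>_. u x" "\<lambda>_. w x"]
    by (simp add: point_vec_def subset_eq)
  moreover have "point_vec M S u = point_vec M S w \<longleftrightarrow> (\<forall>x\<in>S. point_vec M S u x = point_vec M S w x)"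
  proof
    assume r: "\<forall>x\<in>S. point_vec M S u x = point_vec M S w x"
    show "point_vec M S u = point_vec M S w"
      by (rule extensionalityI[of _ S]) (use r in \<open>simp_all only: point_vec_def restrict_extensional\<close>)
  qed simp
  ultimately show ?thesis by simp
qed

lemma carrier_point_module:
  "carrier (point_module M S) = point_vec M S ` {u. finite {x \<in> S. u x \<noteq> 0}}"
proof -
  have grp: "\<And>x. x \<in> S \<Longrightarrow> group (add_monoid (holo_stalk M x Quot max_ideal M x))"
    by (rule residue_group) (use S in \<open>simp add: subset_eq\<close>)
  have c: "carrier (point_module M S) =
    {p \<in> \<Pi>\<^sub>E x\<in>S. carrier (holo_stalk M x Quot max_ideal M x). finite {x \<in> S. p x \<noteq> max_ideal M x}}"
    using carrier_sum_group[OF grp, of S] unfolding point_module_def by (simp add: zero_residue)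
  have z: "{x \<in> S. point_vec M S u x \<noteq> max_ideal M x} = {x \<in> S. u x \<noteq> 0}" for u
  proof -
    have "point_vec M S u x = max_ideal M x \<longleftrightarrow> u x = 0" if "x \<in> S" for x
      using that S max_ideal_coset_eq_iff[of M x "\<lambda>_. u x" "\<lambda>_. 0"] coset_zero[of x M]
      by (simp add: point_vec_def subset_eq)
    then show ?thesis by blast
  qed
  show ?thesis
  proof (intro equalityI subsetI)
    fix p assume p: "p \<in> carrier (point_module M S)"
    have "\<exists>c. p x = max_ideal M x +>\<^bsub>holo_stalk M x\<^esub> holo_germ M x (\<lambda>_. c)" if x: "x \<in> S" for x
    proof -
      have "p x \<in> carrier (holo_stalk M x Quot max_ideal M x)"
        using p x unfolding c by (simp add: PiE_iff)
      then obtain a where a: "a \<in> carrier (holo_stalk M x)" "p x = max_ideal M x +>\<^bsub>holo_stalk M x\<^esub> a"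
        unfolding carrier_residue by blast
      obtain f where f: "holo_at M x f" "a = holo_germ M x f"
        using a(1) by (rule holo_stalkE)
      show ?thesis
        using max_ideal_coset_eq_iff[of M x f "\<lambda>_. f x"] f a(2) holo_at_const holo_at_topspace[OF f(1)]
        by (intro exI[of _ "f x"]) simp
    qed
    then obtain u where u: "\<And>x. x \<in> S \<Longrightarrow>
        p x = max_ideal M x +>\<^bsub>holo_stalk M x\<^esub> holo_germ M x (\<lambda>_. u x)"
      by metis
    have pu: "p = point_vec M S u"
      by (rule extensionalityI[of _ S]) (use p u in \<open>simp_all add: c point_vec_def PiE_iff\<close>)
    moreover have "finite {x \<in> S. u x \<noteq> 0}"
      using p unfolding c pu by (simp add: z)
    ultimately show "p \<in> point_vec M S ` {u. finite {x \<in> S. u x \<noteq> 0}}" by blast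
  next
    fix p assume "p \<in> point_vec M S ` {u. finite {x \<in> S. u x \<noteq> 0}}"
    then obtain u where u: "p = point_vec M S u" "finite {x \<in> S. u x \<noteq> 0}" by blast
    have "point_vec M S u x \<in> carrier (holo_stalk M x Quot max_ideal M x)" if "x \<in> S" for x
      using that S by (auto simp: carrier_residue point_vec_def intro!: exI mem_holo_stalk)
    moreover have "point_vec M S u \<in> extensional S" by (simp add: point_vec_def)
    ultimately show "p \<in> carrier (point_module M S)"
      unfolding c u using u(2) by (simp add: z PiE_iff)
  qed
qed

lemma one_point_module: "\<one>\<^bsub>point_module M S\<^esub> = point_vec M S (\<lambda>_. 0)"
  unfolding point_module_def point_vec_def one_sum_group
  by (rule restrict_ext) (use S coset_zero[of _ M] in \<open>simp add: zero_residue subset_eq\<close>)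

lemma mult_point_module:
  "point_vec M S u \<otimes>\<^bsub>point_module M S\<^esub> point_vec M S w = point_vec M S (\<lambda>x. u x + w x)"
  unfolding point_module_def point_vec_def mult_sum_group
  by (rule restrict_ext) (use S coset_add[of _ M] in \<open>simp add: subset_eq\<close>)

lemma group_point_module: "group (point_module M S)"
  unfolding point_module_def
  by (rule sum_group, rule residue_group) (use S in \<open>simp add: subset_eq\<close>)

end

section \<open>The action on points\<close>

context complex_lie_grp
begin

context
  fixes S assumes S: "S \<subseteq> carrier G"
begin

lemma mem_topspace: "x \<in> S \<Longrightarrow> x \<in> topspace (mtop M)"
  using S topspace_eq by auto

lemma S_topspace: "S \<subseteq> topspace (mtop M)"
  using S topspace_eq by auto

lemma carrier_mero_sum: "carrier (mero_sum G M) =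
    {F \<in> \<Pi>\<^sub>E x\<in>carrier G. carrier (mero_stalk M x). finite {x \<in> carrier G. F x \<noteq> \<zero>\<^bsub>mero_stalk M x\<^esub>}}"
proof -
  have "group (add_monoid (mero_stalk M x))" if "x \<in> carrier G" for x
  proof -
    interpret cring "mero_stalk M x" by (rule mero_stalk_cring) (simp add: topspace_eq that)
    show ?thesis by (rule a_group)
  qed
  then show ?thesis unfolding mero_sum_def by (simp add: carrier_sum_group)
qed

lemma const_family_in_holo_sum:
  assumes "finite {x \<in> S. u x \<noteq> 0}"
  shows "(\<lambda>x\<in>carrier G. if x \<in> S then holo_germ M x (\<lambda>_. u x) else \<zero>\<^bsub>mero_stalk M x\<^esub>) \<in> holo_sum G M S"
    (is "?F \<in> _")
proof -
  have "{x \<in> carrier G. ?F x \<noteq> \<zero>\<^bsub>mero_stalk M x\<^esub>} \<subseteq> {x \<in> S. u x \<noteq> 0}"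
  proof (rule subsetI)
    fix x assume "x \<in> {x \<in> carrier G. ?F x \<noteq> \<zero>\<^bsub>mero_stalk M x\<^esub>}"
    then have "x \<in> S" "holo_germ M x (\<lambda>_. u x) \<noteq> \<zero>\<^bsub>mero_stalk M x\<^esub>"
      by (simp_all split: if_splits)
    then show "x \<in> {x \<in> S. u x \<noteq> 0}" by (auto simp: mero_stalk_zero)
  qed
  then have "finite {x \<in> carrier G. ?F x \<noteq> \<zero>\<^bsub>mero_stalk M x\<^esub>}"
    using assms finite_subset by blast
  moreover have "?F x \<in> carrier (mero_stalk M x)" if "x \<in> carrier G" for x
    using that topspace_eq by (simp add: mero_stalk_zero holo_germ_closed)
  moreover have "?F x \<in> carrier (holo_stalk M x)" if "x \<in> S" for x
    using that S mem_topspace by (simp add: mem_holo_stalk subset_eq)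
  ultimately show ?thesis
    unfolding holo_sum_def carrier_mero_sum by simp
qed

lemma holo_sum_representatives:
  assumes "F \<in> holo_sum G M S"
  shows "\<exists>\<phi>. \<forall>x\<in>S. holo_at M x (\<phi> x) \<and> F x = holo_germ M x (\<phi> x)"
proof (rule bchoice, rule ballI)
  fix x assume "x \<in> S"
  then have "F x \<in> carrier (holo_stalk M x)" using assms unfolding holo_sum_def by simp
  then obtain f where "holo_at M x f" "F x = holo_germ M x f" by (rule holo_stalkE)
  then show "\<exists>f. holo_at M x f \<and> F x = holo_germ M x f" by (intro exI conjI)
qed

text \<open>Projecting to residue fields evaluates each germ at its base point.\<close>

lemma point_proj_holo_sum:
  assumes "F \<in> holo_sum G M S" "\<And>x. x \<in> S \<Longrightarrow> holo_at M x (\<phi> x)"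
    "\<And>x. x \<in> S \<Longrightarrow> F x = holo_germ M x (\<phi> x)"
  shows "point_proj M S F = point_vec M S (\<lambda>x. \<phi> x x)" "finite {x \<in> S. \<phi> x x \<noteq> 0}"
proof -
  show "point_proj M S F = point_vec M S (\<lambda>x. \<phi> x x)"
    unfolding point_proj_def point_vec_def
  proof (rule restrict_ext)
    fix x assume x: "x \<in> S"
    show "max_ideal M x +>\<^bsub>holo_stalk M x\<^esub> F x =
        max_ideal M x +>\<^bsub>holo_stalk M x\<^esub> holo_germ M x (\<lambda>_. \<phi> x x)"
      using max_ideal_coset_eq_iff[OF assms(2)[OF x] holo_at_const[OF mem_topspace[OF x]], of "\<phi> x x"]
        assms(3)[OF x] by simp
  qed
  have "{x \<in> S. \<phi> x x \<noteq> 0} \<subseteq> {x \<in> carrier G. F x \<noteq> \<zero>\<^bsub>mero_stalk M x\<^esub>}"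
  proof (rule subsetI, clarsimp)
    fix x assume x: "x \<in> S" "\<phi> x x \<noteq> 0"
    have "F x \<noteq> \<zero>\<^bsub>mero_stalk M x\<^esub>"
      using holo_germ_eqD[OF assms(2)[OF x(1)] holo_at_const[OF mem_topspace[OF x(1)]], of 0]
        assms(3)[OF x(1)] x(2) by (auto simp: mero_stalk_zero)
    then show "x \<in> carrier G \<and> F x \<noteq> \<zero>\<^bsub>mero_stalk M x\<^esub>" using S x by auto
  qed
  then show "finite {x \<in> S. \<phi> x x \<noteq> 0}"
    using assms(1) finite_subset unfolding holo_sum_def carrier_mero_sum by blast
qed

lemma point_proj_image: "point_proj M S ` holo_sum G M S = carrier (point_module M S)"
proof (intro equalityI subsetI)
  fix p assume "p \<in> point_proj M S ` holo_sum G M S"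
  then obtain F where F: "F \<in> holo_sum G M S" "p = point_proj M S F" by blast
  obtain \<phi> where "\<forall>x\<in>S. holo_at M x (\<phi> x) \<and> F x = holo_germ M x (\<phi> x)"
    using holo_sum_representatives[OF F(1)] by (rule exE)
  then have \<phi>: "\<And>x. x \<in> S \<Longrightarrow> holo_at M x (\<phi> x)" "\<And>x. x \<in> S \<Longrightarrow> F x = holo_germ M x (\<phi> x)"
    by simp_all
  show "p \<in> carrier (point_module M S)"
    using point_proj_holo_sum[OF F(1) \<phi>] F(2) unfolding carrier_point_module[OF S_topspace]
    by simp
next
  fix p assume "p \<in> carrier (point_module M S)"
  then obtain u where u: "p = point_vec M S u" "finite {x \<in> S. u x \<noteq> 0}"
    unfolding carrier_point_module[OF S_topspace] by blast
  have "point_vec M S u = point_proj M S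
      (\<lambda>x\<in>carrier G. if x \<in> S then holo_germ M x (\<lambda>_. u x) else \<zero>\<^bsub>mero_stalk M x\<^esub>)"
    unfolding point_proj_def point_vec_def using S by (intro restrict_ext) auto
  then show "p \<in> point_proj M S ` holo_sum G M S"
    using const_family_in_holo_sum[OF u(2)] u(1) by (simp only: image_eqI)
qed

lemma point_act_closed:
  assumes "\<And>F. F \<in> holo_sum G M S \<Longrightarrow> skew_act G M A F \<in> holo_sum G M S"
    and "p \<in> carrier (point_module M S)"
  shows "point_act G M S A p \<in> carrier (point_module M S)"
proof -
  have "inv_into (holo_sum G M S) (point_proj M S) p \<in> holo_sum G M S"
    using assms(2) unfolding point_proj_image[symmetric] by (rule inv_into_into)
  then show ?thesis
    unfolding point_act_def point_proj_image[symmetric] using assms(1) by blast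
qed

text \<open>The lift \<open>F\<close> chosen in the induced action need not consist of constant germs, and it may be nonzero at
  points where \<open>u\<close> vanishes.  Only the values \<open>\<phi> x x = u x\<close> are known, and they suffice since all
  coefficients are holomorphic.  The set \<open>K\<close> may exceed the support of \<open>A\<close>, so that a list of formal
  terms can be used even if some coefficients vanish.\<close>

lemma point_act_eq:
  assumes K: "finite K" "K \<subseteq> carrier G" "skew_supp G M A \<subseteq> K"
    and SK: "\<And>\<xi> y. \<xi> \<in> K \<Longrightarrow> y \<in> S \<Longrightarrow> inv\<^bsub>G\<^esub> \<xi> \<otimes>\<^bsub>G\<^esub> y \<in> S"
    and c: "\<And>\<xi> y. \<xi> \<in> K \<Longrightarrow> y \<in> S \<Longrightarrow> holo_at M y (c \<xi> y)"
      "\<And>\<xi> y. \<xi> \<in> K \<Longrightarrow> y \<in> S \<Longrightarrow> A \<xi> y = holo_germ M y (c \<xi> y)"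
    and u: "finite {x \<in> S. u x \<noteq> 0}"
  shows "point_act G M S A (point_vec M S u) =
    point_vec M S (\<lambda>y. \<Sum>\<xi>\<in>K. c \<xi> y y * u (inv\<^bsub>G\<^esub> \<xi> \<otimes>\<^bsub>G\<^esub> y))"
proof -
  define F where "F = inv_into (holo_sum G M S) (point_proj M S) (point_vec M S u)"
  have pu: "point_vec M S u \<in> point_proj M S ` holo_sum G M S"
    unfolding point_proj_image carrier_point_module[OF S_topspace] using u by blast
  have F: "F \<in> holo_sum G M S" "point_proj M S F = point_vec M S u"
    unfolding F_def using inv_into_into[OF pu] f_inv_into_f[OF pu] by simp_all
  obtain \<phi> where "\<forall>x\<in>S. holo_at M x (\<phi> x) \<and> F x = holo_germ M x (\<phi> x)"
    using holo_sum_representatives[OF F(1)] by (rule exE)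
  then have \<phi>: "\<And>x. x \<in> S \<Longrightarrow> holo_at M x (\<phi> x)" "\<And>x. x \<in> S \<Longrightarrow> F x = holo_germ M x (\<phi> x)"
    by simp_all
  have \<phi>u: "\<phi> x x = u x" if "x \<in> S" for x
  proof -
    have "point_vec M S (\<lambda>x. \<phi> x x) = point_vec M S u"
      using point_proj_holo_sum(1)[OF F(1) \<phi>] F(2) by simp
    then show ?thesis using that unfolding point_vec_eq_iff[OF S_topspace] by simp
  qed
  have supp: "finite (skew_supp G M A)" using K finite_subset by blast
  show ?thesis
    unfolding point_act_def F_def[symmetric]
    unfolding point_proj_def point_vec_def
  proof (rule restrict_ext)
    fix y assume y: "y \<in> S"
    have yG: "y \<in> carrier G" using y S by auto
    interpret R: cring "mero_stalk M y" by (rule mero_stalk_cring[OF mem_topspace[OF y]])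
    define e where "e \<xi> z = c \<xi> y z * \<phi> (inv\<^bsub>G\<^esub> \<xi> \<otimes>\<^bsub>G\<^esub> y) (inv\<^bsub>G\<^esub> \<xi> \<otimes>\<^bsub>G\<^esub> z)" for \<xi> z
    have e: "holo_at M y (e \<xi>)"
      "A \<xi> y \<otimes>\<^bsub>mero_stalk M y\<^esub>
        translate_germ G M \<xi> (inv\<^bsub>G\<^esub> \<xi> \<otimes>\<^bsub>G\<^esub> y) (F (inv\<^bsub>G\<^esub> \<xi> \<otimes>\<^bsub>G\<^esub> y)) = holo_germ M y (e \<xi>)"
      if "\<xi> \<in> K" for \<xi>
    proof -
      have \<xi>: "\<xi> \<in> carrier G" "inv\<^bsub>G\<^esub> \<xi> \<in> carrier G" "\<xi> \<otimes>\<^bsub>G\<^esub> (inv\<^bsub>G\<^esub> \<xi> \<otimes>\<^bsub>G\<^esub> y) = y"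
        using that K(2) yG by (auto simp: m_assoc[symmetric])
      have w: "inv\<^bsub>G\<^esub> \<xi> \<otimes>\<^bsub>G\<^esub> y \<in> S" using SK[OF that y] .
      have h: "holo_at M y (\<lambda>z. \<phi> (inv\<^bsub>G\<^esub> \<xi> \<otimes>\<^bsub>G\<^esub> y) (inv\<^bsub>G\<^esub> \<xi> \<otimes>\<^bsub>G\<^esub> z))"
        by (rule holo_at_left_translation[OF \<xi>(2) yG \<phi>(1)[OF w]])
      show "holo_at M y (e \<xi>)"
        unfolding e_def by (rule holo_at_mult[OF c(1)[OF that y] h])
      have "translate_germ G M \<xi> (inv\<^bsub>G\<^esub> \<xi> \<otimes>\<^bsub>G\<^esub> y) (F (inv\<^bsub>G\<^esub> \<xi> \<otimes>\<^bsub>G\<^esub> y)) =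
          holo_germ M y (\<lambda>z. \<phi> (inv\<^bsub>G\<^esub> \<xi> \<otimes>\<^bsub>G\<^esub> y) (inv\<^bsub>G\<^esub> \<xi> \<otimes>\<^bsub>G\<^esub> z))"
        using translate_holo_germ[OF \<xi>(1) _ \<phi>(1)[OF w]] w S \<phi>(2)[OF w] \<xi>(3) by auto
      then show "A \<xi> y \<otimes>\<^bsub>mero_stalk M y\<^esub>
        translate_germ G M \<xi> (inv\<^bsub>G\<^esub> \<xi> \<otimes>\<^bsub>G\<^esub> y) (F (inv\<^bsub>G\<^esub> \<xi> \<otimes>\<^bsub>G\<^esub> y)) = holo_germ M y (e \<xi>)"
        unfolding e_def c(2)[OF that y] using holo_germ_mult[OF c(1)[OF that y] h] by simp
    qed
    have "skew_act G M A F y = (\<Oplus>\<^bsub>mero_stalk M y\<^esub>\<xi>\<in>skew_supp G M A. holo_germ M y (e \<xi>))"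
      unfolding skew_act_def restrict_apply'[OF yG]
    proof (rule R.finsum_cong'[OF refl])
      show "(\<lambda>\<xi>. holo_germ M y (e \<xi>)) \<in> skew_supp G M A \<rightarrow> carrier (mero_stalk M y)"
        using e(1) K(3) by (auto intro!: holo_germ_closed)
    qed (use e(2) K(3) in \<open>simp add: subset_eq\<close>)
    also have "\<dots> = holo_germ M y (\<lambda>z. \<Sum>\<xi>\<in>skew_supp G M A. e \<xi> z)"
      using e(1) K(3) by (intro holo_germ_sum[OF mem_topspace[OF y] supp]) blast
    finally have act: "skew_act G M A F y = holo_germ M y (\<lambda>z. \<Sum>\<xi>\<in>skew_supp G M A. e \<xi> z)" .
    have "(\<Sum>\<xi>\<in>skew_supp G M A. e \<xi> y) = (\<Sum>\<xi>\<in>skew_supp G M A. c \<xi> y y * u (inv\<^bsub>G\<^esub> \<xi> \<otimes>\<^bsub>G\<^esub> y))"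
      unfolding e_def using \<phi>u SK y K(3) by (intro sum.cong) (auto simp: subset_eq)
    also have "\<dots> = (\<Sum>\<xi>\<in>K. c \<xi> y y * u (inv\<^bsub>G\<^esub> \<xi> \<otimes>\<^bsub>G\<^esub> y))"
    \<comment> \<open>outside the support the germ of \<open>c \<xi> y\<close> is zero, hence so is its value\<close>
    proof (rule sum.mono_neutral_left[OF K(1,3)], rule ballI)
      fix \<xi> assume \<xi>: "\<xi> \<in> K - skew_supp G M A"
      then have "A \<xi> = \<zero>\<^bsub>mero_ring M\<^esub>" using K(2) unfolding skew_supp_def by auto
      then have "holo_germ M y (c \<xi> y) = holo_germ M y (\<lambda>_. 0)"
        using c(2)[of \<xi> y] \<xi> y mem_topspace[OF y] by (simp add: mero_stalk_zero)
      then have "c \<xi> y y = 0"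
        using holo_germ_eqD[OF c(1)[of \<xi> y] holo_at_const[OF mem_topspace[OF y]], of 0] \<xi> y by simp
      then show "c \<xi> y y * u (inv\<^bsub>G\<^esub> \<xi> \<otimes>\<^bsub>G\<^esub> y) = 0" by simp
    qed
    finally have val: "(\<Sum>\<xi>\<in>skew_supp G M A. e \<xi> y) = (\<Sum>\<xi>\<in>K. c \<xi> y y * u (inv\<^bsub>G\<^esub> \<xi> \<otimes>\<^bsub>G\<^esub> y))" .
    have "holo_at M y (\<lambda>z. \<Sum>\<xi>\<in>skew_supp G M A. e \<xi> z)"
      using e(1) K(3) by (intro holo_at_sum[OF mem_topspace[OF y]]) blast
    from max_ideal_coset_eq_iff[OF this holo_at_const[OF mem_topspace[OF y]]]
    show "max_ideal M y +>\<^bsub>holo_stalk M y\<^esub> skew_act G M A F y =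
        max_ideal M y +>\<^bsub>holo_stalk M y\<^esub>
          holo_germ M y (\<lambda>_. \<Sum>\<xi>\<in>K. c \<xi> y y * u (inv\<^bsub>G\<^esub> \<xi> \<otimes>\<^bsub>G\<^esub> y))"
      unfolding act using val by simp
  qed
qed

text \<open>Act on the family of germs that is 1 at \<open>\<xi>\<inverse> y\<close> and 0 elsewhere: only the term with \<open>\<phi>\<^sub>\<xi>\<close> reaches
  \<open>y\<close>, where it leaves the coefficient itself.\<close>

lemma coefficient_holomorphic:
  assumes A: "A \<in> carrier (skew_ring G M)"
    and pres: "\<And>F. F \<in> holo_sum G M S \<Longrightarrow> skew_act G M A F \<in> holo_sum G M S"
    and \<xi>: "\<xi> \<in> carrier G" and y: "y \<in> S" and x: "inv\<^bsub>G\<^esub> \<xi> \<otimes>\<^bsub>G\<^esub> y \<in> S"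
  shows "A \<xi> y \<in> carrier (holo_stalk M y)"
proof -
  let ?x = "inv\<^bsub>G\<^esub> \<xi> \<otimes>\<^bsub>G\<^esub> y"
  have yG: "y \<in> carrier G" using y S by auto
  interpret R: cring "mero_stalk M y" by (rule mero_stalk_cring[OF mem_topspace[OF y]])
  define u where "u z = (if z = ?x then 1 else 0 :: complex)" for z
  define F where "F = (\<lambda>z\<in>carrier G. if z \<in> S then holo_germ M z (\<lambda>_. u z) else \<zero>\<^bsub>mero_stalk M z\<^esub>)"
  have F: "F \<in> holo_sum G M S"
    unfolding F_def
    by (rule const_family_in_holo_sum, rule finite_subset[of _ "{?x}"]) (auto simp: u_def)
  have Fz: "F z = holo_germ M z (\<lambda>_. u z)" if "z \<in> carrier G" for z
    unfolding F_def using that x by (auto simp: u_def mero_stalk_zero)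
  have Ay: "A \<zeta> y \<in> carrier (mero_stalk M y)" if "\<zeta> \<in> carrier G" for \<zeta>
    using A that yG by (simp add: skew_ring_carrier_iff PiE_iff mero_functions_stalk topspace_eq)
  have supp: "finite (skew_supp G M A)" using A by (simp add: skew_ring_carrier_iff)
  have summand: "A \<zeta> y \<otimes>\<^bsub>mero_stalk M y\<^esub>
      translate_germ G M \<zeta> (inv\<^bsub>G\<^esub> \<zeta> \<otimes>\<^bsub>G\<^esub> y) (F (inv\<^bsub>G\<^esub> \<zeta> \<otimes>\<^bsub>G\<^esub> y)) =
      (if \<zeta> = \<xi> then A \<zeta> y else \<zero>\<^bsub>mero_stalk M y\<^esub>)" if \<zeta>: "\<zeta> \<in> carrier G" for \<zeta>
  proof -
    have w: "inv\<^bsub>G\<^esub> \<zeta> \<otimes>\<^bsub>G\<^esub> y \<in> carrier G" "\<zeta> \<otimes>\<^bsub>G\<^esub> (inv\<^bsub>G\<^esub> \<zeta> \<otimes>\<^bsub>G\<^esub> y) = y"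
      using \<zeta> yG by (auto simp: m_assoc[symmetric])
    have "inv\<^bsub>G\<^esub> \<zeta> \<otimes>\<^bsub>G\<^esub> y = ?x \<longleftrightarrow> \<zeta> = \<xi>"
      using \<zeta> \<xi> yG by (metis inv_closed inv_inv right_cancel)
    then have "u (inv\<^bsub>G\<^esub> \<zeta> \<otimes>\<^bsub>G\<^esub> y) = (if \<zeta> = \<xi> then 1 else 0)" by (simp add: u_def)
    moreover have "translate_germ G M \<zeta> (inv\<^bsub>G\<^esub> \<zeta> \<otimes>\<^bsub>G\<^esub> y) (F (inv\<^bsub>G\<^esub> \<zeta> \<otimes>\<^bsub>G\<^esub> y)) =
        holo_germ M y (\<lambda>_. u (inv\<^bsub>G\<^esub> \<zeta> \<otimes>\<^bsub>G\<^esub> y))"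
      unfolding Fz[OF w(1)] using translate_holo_germ[OF \<zeta> w(1) holo_at_const] w topspace_eq by simp
    ultimately show ?thesis
      using Ay[OF \<zeta>]
      by (cases "\<zeta> = \<xi>") (simp_all add: mero_stalk_zero[symmetric] mero_stalk_one[symmetric])
  qed
  have suppG: "skew_supp G M A \<subseteq> carrier G" unfolding skew_supp_def by auto
  have act: "skew_act G M A F y =
      (\<Oplus>\<^bsub>mero_stalk M y\<^esub>\<zeta>\<in>skew_supp G M A. if \<zeta> = \<xi> then A \<zeta> y else \<zero>\<^bsub>mero_stalk M y\<^esub>)"
    unfolding skew_act_def restrict_apply'[OF yG]
    by (rule R.finsum_cong'[OF refl]) (use summand suppG Ay in \<open>simp_all add: subset_eq\<close>)
  have "A \<xi> y = skew_act G M A F y"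
  proof (cases "\<xi> \<in> skew_supp G M A")
    case True
    then show ?thesis unfolding act
      using R.add.finprod_singleton_swap[OF True supp, of "\<lambda>\<zeta>. A \<zeta> y"] Ay suppG
      by (simp add: subset_eq)
  next
    case False
    then have "skew_act G M A F y = (\<Oplus>\<^bsub>mero_stalk M y\<^esub>\<zeta>\<in>skew_supp G M A. \<zero>\<^bsub>mero_stalk M y\<^esub>)"
      unfolding act by (intro R.finsum_cong') auto
    moreover have "A \<xi> y = \<zero>\<^bsub>mero_stalk M y\<^esub>"
      using False \<xi> yG unfolding skew_supp_def by (simp add: topspace_eq)
    ultimately show ?thesis by simp
  qed
  then show ?thesis using pres[OF F] y unfolding holo_sum_def by simp
qed

end

end

section \<open>Spaces of finitely supported functions\<close>

text \<open>Induction on the support size: if \<open>h\<close> separates \<open>x\<close> from another support point \<open>y\<close>, then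
  \<open>(h - h y) u\<close> has smaller support and is still nonzero at \<open>x\<close>.  Closure under congruence on \<open>S\<close>
  expresses that only the values on \<open>S\<close> matter.\<close>

lemma separated_delta:
  fixes N H :: "('v \<Rightarrow> complex) set"
  assumes add: "\<And>u w. u \<in> N \<Longrightarrow> w \<in> N \<Longrightarrow> (\<lambda>x. u x + w x) \<in> N"
    and mult: "\<And>h u. h \<in> H \<Longrightarrow> u \<in> N \<Longrightarrow> (\<lambda>x. h x * u x) \<in> N"
    and cong: "\<And>u w. u \<in> N \<Longrightarrow> (\<And>x. x \<in> S \<Longrightarrow> u x = w x) \<Longrightarrow> w \<in> N"
    and const: "\<And>c. (\<lambda>_. c) \<in> H"
    and separates: "\<And>x y. x \<in> S \<Longrightarrow> y \<in> S \<Longrightarrow> x \<noteq> y \<Longrightarrow> \<exists>h\<in>H. h x \<noteq> h y"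
    and u: "u \<in> N" "finite {z \<in> S. u z \<noteq> 0}" "x \<in> S" "u x \<noteq> 0"
  shows "(\<lambda>z. if z = x then c else 0) \<in> N"
  using u
proof (induction "card {z \<in> S. u z \<noteq> 0}" arbitrary: u rule: less_induct)
  case less
  show ?case
  proof (cases "\<exists>y\<in>S. y \<noteq> x \<and> u y \<noteq> 0")
    case True
    then obtain y where y: "y \<in> S" "y \<noteq> x" "u y \<noteq> 0" by blast
    then obtain h where h: "h \<in> H" "h x \<noteq> h y" using separates less.prems(3) by metis
    \<comment> \<open>\<open>(h - h y) u\<close>, written so that closure under products with \<open>h\<close> and with constants applies\<close>
    let ?w = "\<lambda>z. h z * u z + (- h y) * u z"
    have "?w \<in> N"
      using add[OF mult[OF h(1) less.prems(1)] mult[OF const less.prems(1)]] .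
    moreover have sub: "{z \<in> S. ?w z \<noteq> 0} \<subset> {z \<in> S. u z \<noteq> 0}"
      using y by (auto intro!: psubsetI)
    moreover have "?w x \<noteq> 0"
      using h less.prems(4) by (simp flip: left_diff_distrib)
    ultimately show ?thesis
      using less.hyps[of ?w] psubset_card_mono[OF less.prems(2) sub]
        finite_subset[OF psubset_imp_subset[OF sub] less.prems(2)] less.prems(3) by blast
  next
    case False
    have "(\<lambda>z. c / u x * u z) \<in> N"
      by (rule mult[OF const less.prems(1)])
    then show ?thesis
      by (rule cong) (use False less.prems(4) in auto)
  qed
qed

lemma finite_support_in_span:
  fixes N :: "('v \<Rightarrow> complex) set"
  assumes add: "\<And>u w. u \<in> N \<Longrightarrow> w \<in> N \<Longrightarrow> (\<lambda>x. u x + w x) \<in> N"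
    and cong: "\<And>u w. u \<in> N \<Longrightarrow> (\<And>x. x \<in> S \<Longrightarrow> u x = w x) \<Longrightarrow> w \<in> N"
    and zero: "(\<lambda>_. 0) \<in> N"
    and delta: "\<And>x c. x \<in> S \<Longrightarrow> (\<lambda>z. if z = x then c else 0) \<in> N"
    and w: "finite {x \<in> S. w x \<noteq> 0}"
  shows "w \<in> N"
proof -
  have "(\<lambda>z. if z \<in> F then w z else 0) \<in> N" if "finite F" "F \<subseteq> S" for F
    using that
  proof (induct F)
    case empty
    show ?case using zero by simp
  next
    case (insert x F)
    have "(\<lambda>z. (if z = x then w x else 0) + (if z \<in> F then w z else 0)) \<in> N"
      using insert by (intro add delta) auto
    then show ?case by (rule cong) (use insert in auto)
  qed
  from this[OF w] show ?thesis by (rule cong) auto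
qed

section \<open>Irreducibility\<close>

context complex_lie_grp
begin

lemma point_act_holo:
  assumes S: "S \<subseteq> carrier G" and h: "h \<in> global_holo M" and u: "finite {x \<in> S. u x \<noteq> 0}"
  shows "point_act G M S (skew_term G M (mero_of_holo M h) \<one>\<^bsub>G\<^esub>) (point_vec M S u) =
    point_vec M S (\<lambda>x. h x * u x)"
proof -
  have "point_act G M S (skew_term G M (mero_of_holo M h) \<one>\<^bsub>G\<^esub>) (point_vec M S u) =
    point_vec M S (\<lambda>y. \<Sum>\<xi>\<in>{\<one>\<^bsub>G\<^esub>}. h y * u (inv\<^bsub>G\<^esub> \<xi> \<otimes>\<^bsub>G\<^esub> y))"
  proof (rule point_act_eq[OF S, where c = "\<lambda>_ _. h"])
    show "skew_supp G M (skew_term G M (mero_of_holo M h) \<one>\<^bsub>G\<^esub>) \<subseteq> {\<one>\<^bsub>G\<^esub>}"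
      unfolding skew_supp_def skew_term_def by auto
    fix \<xi> y assume \<xi>: "\<xi> \<in> {\<one>\<^bsub>G\<^esub>}" and y: "y \<in> S"
    then have yG: "y \<in> carrier G" using S by auto
    show "inv\<^bsub>G\<^esub> \<xi> \<otimes>\<^bsub>G\<^esub> y \<in> S" using \<xi> y yG by simp
    show "holo_at M y h" using h yG by (simp add: global_holo_at topspace_eq)
    show "skew_term G M (mero_of_holo M h) \<one>\<^bsub>G\<^esub> \<xi> y = holo_germ M y h"
      using \<xi> yG by (simp add: skew_term_def mero_of_holo_def topspace_eq)
  qed (use u in auto)
  also have "\<dots> = point_vec M S (\<lambda>x. h x * u x)"
    unfolding point_vec_eq_iff[OF S_topspace[OF S]] using S by (auto simp: subset_eq)
  finally show ?thesis .
qed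

lemma orbit_translate:
  assumes H: "subgroup H G" and v: "v \<in> carrier G" and g: "g \<in> H" and y: "y \<in> H #>\<^bsub>G\<^esub> v"
  shows "g \<otimes>\<^bsub>G\<^esub> y \<in> H #>\<^bsub>G\<^esub> v"
proof -
  obtain h where h: "h \<in> H" "y = h \<otimes>\<^bsub>G\<^esub> v" using y unfolding r_coset_def by blast
  have "g \<otimes>\<^bsub>G\<^esub> y = (g \<otimes>\<^bsub>G\<^esub> h) \<otimes>\<^bsub>G\<^esub> v"
    using h g v subgroup.mem_carrier[OF H] by (simp add: m_assoc)
  moreover have "g \<otimes>\<^bsub>G\<^esub> h \<in> H" using subgroup.m_closed[OF H g h(1)] .
  ultimately show ?thesis unfolding r_coset_def by blast
qed

lemma orbit_transitive:
  assumes H: "subgroup H G" and v: "v \<in> carrier G"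
    and x: "x \<in> H #>\<^bsub>G\<^esub> v" and y: "y \<in> H #>\<^bsub>G\<^esub> v"
  obtains g where "g \<in> H" "y = g \<otimes>\<^bsub>G\<^esub> x"
proof -
  obtain h k where h: "h \<in> H" "x = h \<otimes>\<^bsub>G\<^esub> v" "k \<in> H" "y = k \<otimes>\<^bsub>G\<^esub> v"
    using x y unfolding r_coset_def by blast
  have hk: "h \<in> carrier G" "k \<in> carrier G" using subgroup.mem_carrier[OF H] h by simp_all
  have "(k \<otimes>\<^bsub>G\<^esub> inv\<^bsub>G\<^esub> h) \<otimes>\<^bsub>G\<^esub> x = k \<otimes>\<^bsub>G\<^esub> (inv\<^bsub>G\<^esub> h \<otimes>\<^bsub>G\<^esub> h) \<otimes>\<^bsub>G\<^esub> v"
    using hk v h by (simp only: m_assoc inv_closed m_closed)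
  then have "y = (k \<otimes>\<^bsub>G\<^esub> inv\<^bsub>G\<^esub> h) \<otimes>\<^bsub>G\<^esub> x" using hk h by simp
  then show thesis
    using that subgroup.m_closed[OF H h(3) subgroup.m_inv_closed[OF H h(1)]] by simp
qed

text \<open>The elements that map \<open>T\<close> into itself form a submonoid.\<close>

lemma submonoid_generated_invariant:
  assumes "\<Xi> \<subseteq> carrier G" "T \<subseteq> carrier G"
    and "\<And>g x. g \<in> \<Xi> \<Longrightarrow> x \<in> T \<Longrightarrow> g \<otimes>\<^bsub>G\<^esub> x \<in> T"
    and "g \<in> submonoid_generated G \<Xi>" "x \<in> T"
  shows "g \<otimes>\<^bsub>G\<^esub> x \<in> T"
proof -
  let ?P = "{g \<in> carrier G. \<forall>x\<in>T. g \<otimes>\<^bsub>G\<^esub> x \<in> T}"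
  have "submonoid ?P G"
    by (rule submonoid.intro) (use assms(2) in \<open>auto simp: m_assoc subset_eq\<close>)
  then have "submonoid_generated G \<Xi> \<subseteq> ?P"
    unfolding submonoid_generated_def using assms(1,3) by (intro hull_minimal) auto
  then show ?thesis using assms(4,5) by auto
qed

end

theorem proposition30:
  fixes V :: "'v monoid"
    and M :: "('v, 'n::finite) cmanifold"
    and v :: 'v
    and I :: "'i set"
    and J :: "'i \<Rightarrow> 'j set"
    and f :: "'i \<Rightarrow> 'j \<Rightarrow> 'v \<Rightarrow> 'v fraction set"
    and \<xi> :: "'i \<Rightarrow> 'j \<Rightarrow> 'v"
    and E :: "'i \<Rightarrow> 'v skew"
    and \<Xi> gimel orbit :: "'v set"
    and \<A> :: "'v skew set"
  assumes "complex_lie_group V M"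
    and "v \<in> carrier V"
    and "finite I"
    and "\<And>i. i \<in> I \<Longrightarrow> finite (J i)"
    and "\<And>i j. i \<in> I \<Longrightarrow> j \<in> J i \<Longrightarrow> f i j \<in> mero_functions M"
    and "\<And>i j. i \<in> I \<Longrightarrow> j \<in> J i \<Longrightarrow> \<xi> i j \<in> carrier V"
    and "\<And>i. i \<in> I \<Longrightarrow> inj_on (\<xi> i) (J i)"
    and "\<And>i. i \<in> I \<Longrightarrow> E i = (\<Oplus>\<^bsub>skew_ring V M\<^esub>j\<in>J i. skew_term V M (f i j) (\<xi> i j))"
    and "\<Xi> = {\<xi> i j | i j. i \<in> I \<and> j \<in> J i}"
    and "gimel = generate V \<Xi>"
    and "orbit = gimel #>\<^bsub>V\<^esub> v"
    and "\<A> = skew_subalgebra V M (E ` I)"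
    and "\<And>A F. A \<in> \<A> \<Longrightarrow> F \<in> holo_sum V M orbit \<Longrightarrow> skew_act V M A F \<in> holo_sum V M orbit"
    and separates: "\<And>x y. x \<in> orbit \<Longrightarrow> y \<in> orbit \<Longrightarrow> x \<noteq> y \<Longrightarrow> \<exists>h\<in>global_holo M. h x \<noteq> h y"
    and monoid_eq_group: "submonoid_generated V \<Xi> = gimel"
    and no_zeros: "\<And>i j x. i \<in> I \<Longrightarrow> j \<in> J i \<Longrightarrow> x \<in> orbit \<Longrightarrow> f i j x \<notin> max_ideal M x"
  shows "irreducible_module \<A> (point_module M orbit) (point_act V M orbit)"
proof -
  interpret complex_lie_grp V M by (rule complex_lie_grp.intro) (rule assms(1))
  have \<Xi>: "\<Xi> \<subseteq> carrier V" using assms(6,9) by blast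
  have gimel: "subgroup gimel V" unfolding assms(10) by (rule generate_is_subgroup[OF \<Xi>])
  have \<Xi>_gimel: "\<Xi> \<subseteq> gimel" unfolding assms(10) by (auto intro: generate.incl)
  have S: "orbit \<subseteq> carrier V"
    unfolding assms(11) using r_coset_subset_G[OF subgroup.subset[OF gimel] assms(2)] .
  note S_top = S_topspace[OF S]
  have v_orbit: "v \<in> orbit"
    unfolding assms(11) using subgroup.one_closed[OF gimel] assms(2)
    by (auto simp: r_coset_def intro!: bexI[of _ "\<one>\<^bsub>V\<^esub>"])
  have translate: "g \<otimes>\<^bsub>V\<^esub> y \<in> orbit" if "g \<in> gimel" "y \<in> orbit" for g y
    using orbit_translate[OF gimel assms(2) that(1)] that(2) unfolding assms(11) .
  have translate_inv: "inv\<^bsub>V\<^esub> g \<otimes>\<^bsub>V\<^esub> y \<in> orbit" if "g \<in> gimel" "y \<in> orbit" for g y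
    using translate[OF subgroup.m_inv_closed[OF gimel that(1)] that(2)] .
  have holo_\<A>: "skew_term V M (mero_of_holo M h) \<one>\<^bsub>V\<^esub> \<in> \<A>" if "h \<in> global_holo M" for h
    unfolding assms(12) skew_subalgebra_def using that by (intro generate_ring.incl) blast
  have E_\<A>: "E i \<in> \<A>" if "i \<in> I" for i
    unfolding assms(12) skew_subalgebra_def using that by (intro generate_ring.incl) blast
  have E: "E i \<in> carrier (skew_ring V M)" "\<And>j. j \<in> J i \<Longrightarrow> E i (\<xi> i j) = f i j"
    "skew_supp V M (E i) \<subseteq> \<xi> i ` J i" if i: "i \<in> I" for i
    using skew_sum_coeffs[OF assms(4)[OF i] assms(7)[OF i] assms(5)[OF i] assms(6)[OF i]]
    unfolding assms(8)[OF i] by simp_all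
  have K: "\<xi> i ` J i \<subseteq> \<Xi>" if "i \<in> I" for i using assms(9) that by blast

  have "\<exists>c. holo_at M y c \<and> E i \<zeta> y = holo_germ M y c \<and> c y \<noteq> 0"
    if i: "i \<in> I" and \<zeta>: "\<zeta> \<in> \<xi> i ` J i" and y: "y \<in> orbit" for i \<zeta> y
  proof -
    have \<zeta>g: "\<zeta> \<in> gimel" using \<zeta> K[OF i] \<Xi>_gimel by blast
    have "E i \<zeta> y \<in> carrier (holo_stalk M y)"
      by (rule coefficient_holomorphic[OF S E(1)[OF i] assms(13)[OF E_\<A>[OF i]]
        subgroup.mem_carrier[OF gimel \<zeta>g] y translate_inv[OF \<zeta>g y]])
    then obtain c where c: "holo_at M y c" "E i \<zeta> y = holo_germ M y c" by (rule holo_stalkE)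
    obtain j where j: "j \<in> J i" "\<zeta> = \<xi> i j" using \<zeta> by blast
    have "c y \<noteq> 0"
      using no_zeros[OF i j(1) y] E(2)[OF i j(1)] c j(2) holo_germ_mem_max_ideal[OF c(1)] by simp
    then show ?thesis using c by (intro exI[of _ c] conjI)
  qed
  then obtain c where c: "\<And>i \<zeta> y. i \<in> I \<Longrightarrow> \<zeta> \<in> \<xi> i ` J i \<Longrightarrow> y \<in> orbit \<Longrightarrow>
      holo_at M y (c i \<zeta> y) \<and> E i \<zeta> y = holo_germ M y (c i \<zeta> y) \<and> c i \<zeta> y y \<noteq> 0"
    by metis
  have act_E: "point_act V M orbit (E i) (point_vec M orbit u) =
      point_vec M orbit (\<lambda>y. \<Sum>\<zeta>\<in>\<xi> i ` J i. c i \<zeta> y y * u (inv\<^bsub>V\<^esub> \<zeta> \<otimes>\<^bsub>V\<^esub> y))"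
    if i: "i \<in> I" and u: "finite {x \<in> orbit. u x \<noteq> 0}" for i u
  proof (rule point_act_eq[where c = "c i", OF S _ _ E(3)[OF i] _ _ _ u])
    show "finite (\<xi> i ` J i)" using assms(4)[OF i] by simp
    show "\<xi> i ` J i \<subseteq> carrier V" using K[OF i] \<Xi> by blast
    show "inv\<^bsub>V\<^esub> \<zeta> \<otimes>\<^bsub>V\<^esub> y \<in> orbit" if "\<zeta> \<in> \<xi> i ` J i" "y \<in> orbit" for \<zeta> y
      using translate_inv K[OF i] \<Xi>_gimel that by blast
  qed (use c[OF i] in simp_all)

  have "N = carrier (point_module M orbit)"
    if N: "submodule_of \<A> (point_module M orbit) (point_act V M orbit) N"
      and nonzero: "N \<noteq> {\<one>\<^bsub>point_module M orbit\<^esub>}" for N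
  proof -
    have sub: "subgroup N (point_module M orbit)"
      and stable: "\<And>A p. A \<in> \<A> \<Longrightarrow> p \<in> N \<Longrightarrow> point_act V M orbit A p \<in> N"
      using N unfolding submodule_of_def by simp_all
    define U where "U = {u. point_vec M orbit u \<in> N}"
    \<comment> \<open>elements of \<open>U\<close> have finite support because \<open>N\<close> lies in the direct sum\<close>
    have fin: "finite {x \<in> orbit. u x \<noteq> 0}" if "u \<in> U" for u
    proof -
      have "point_vec M orbit u \<in> carrier (point_module M orbit)"
        using that subgroup.mem_carrier[OF sub] unfolding U_def by simp
      then obtain w where w: "finite {x \<in> orbit. w x \<noteq> 0}"
        "point_vec M orbit u = point_vec M orbit w"
        unfolding carrier_point_module[OF S_top] by blast
      have "{x \<in> orbit. u x \<noteq> 0} = {x \<in> orbit. w x \<noteq> 0}"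
        using w(2) unfolding point_vec_eq_iff[OF S_top] by auto
      then show ?thesis using w(1) by simp
    qed
    have add: "(\<lambda>x. u x + w x) \<in> U" if "u \<in> U" "w \<in> U" for u w
      using subgroup.m_closed[OF sub, of "point_vec M orbit u" "point_vec M orbit w"] that
      unfolding U_def by (simp add: mult_point_module[OF S_top])
    have cong: "w \<in> U" if "u \<in> U" "\<And>x. x \<in> orbit \<Longrightarrow> u x = w x" for u w
    proof -
      have "point_vec M orbit u = point_vec M orbit w"
        using that(2) unfolding point_vec_eq_iff[OF S_top] by simp
      then show ?thesis using that(1) unfolding U_def by simp
    qed
    have mult: "(\<lambda>x. h x * u x) \<in> U" if "h \<in> global_holo M" "u \<in> U" for h u
      using stable[OF holo_\<A>[OF that(1)], of "point_vec M orbit u"] that(2)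
        point_act_holo[OF S that(1) fin[OF that(2)]]
      unfolding U_def by simp
    have zero: "(\<lambda>_. 0) \<in> U"
      using subgroup.one_closed[OF sub] unfolding U_def by (simp add: one_point_module[OF S_top])
    have const: "(\<lambda>_. a) \<in> global_holo M" for a
      unfolding global_holo_def by (simp add: holo_fun_on_const)
    have delta: "(\<lambda>z. if z = x then a else 0) \<in> U" if "u \<in> U" "x \<in> orbit" "u x \<noteq> 0" for u x a
      by (rule separated_delta[of U "global_holo M" orbit u x])
        (fact add mult cong const separates that fin[OF that(1)])+
    define T where "T = {x \<in> orbit. \<forall>a. (\<lambda>z. if z = x then a else 0) \<in> U}"
    have T: "g \<otimes>\<^bsub>V\<^esub> x \<in> T" if g: "g \<in> \<Xi>" and x: "x \<in> T" for g x
    proof -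
      have xS: "x \<in> orbit" and xV: "x \<in> carrier V" using x S unfolding T_def by auto
      have gV: "g \<in> carrier V" using g \<Xi> by blast
      obtain i j where ij: "i \<in> I" "j \<in> J i" "g = \<xi> i j" using g assms(9) by blast
      have gK: "g \<in> \<xi> i ` J i" using ij by blast
      let ?y = "g \<otimes>\<^bsub>V\<^esub> x"
      have y: "?y \<in> orbit" using translate g \<Xi>_gimel xS by blast
      define u where "u z = (if z = x then 1 else 0 :: complex)" for z
      have u: "u \<in> U" using x unfolding T_def u_def by simp
      \<comment> \<open>the image of the delta function at \<open>x\<close> under \<open>E i\<close>\<close>
      define w where "w y = (\<Sum>\<zeta>\<in>\<xi> i ` J i. c i \<zeta> y y * u (inv\<^bsub>V\<^esub> \<zeta> \<otimes>\<^bsub>V\<^esub> y))" for y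
      have w: "w \<in> U"
        using stable[OF E_\<A>[OF ij(1)], of "point_vec M orbit u"] u act_E[OF ij(1) fin[OF u]]
        unfolding U_def w_def by simp
      have "u (inv\<^bsub>V\<^esub> \<zeta> \<otimes>\<^bsub>V\<^esub> ?y) = (if \<zeta> = g then 1 else 0)" if "\<zeta> \<in> \<xi> i ` J i" for \<zeta>
      proof -
        have \<zeta>: "\<zeta> \<in> carrier V" using that K[OF ij(1)] \<Xi> by blast
        have "inv\<^bsub>V\<^esub> \<zeta> \<otimes>\<^bsub>V\<^esub> ?y = x \<longleftrightarrow> \<zeta> = g"
          using \<zeta> gV xV by (metis inv_solve_left' m_closed right_cancel)
        then show ?thesis by (simp add: u_def)
      qed
      then have "w ?y = (\<Sum>\<zeta>\<in>\<xi> i ` J i. if \<zeta> = g then c i \<zeta> ?y ?y else 0)"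
        unfolding w_def by (intro sum.cong) auto
      also have "\<dots> = c i g ?y ?y" using gK assms(4)[OF ij(1)] by simp
      finally have "w ?y \<noteq> 0" using c[OF ij(1) gK y] by simp
      then show ?thesis
        using delta[OF w y] y unfolding T_def by simp
    qed
    obtain p where p: "p \<in> N" "p \<noteq> \<one>\<^bsub>point_module M orbit\<^esub>"
      using nonzero subgroup.one_closed[OF sub] by blast
    obtain u where u: "p = point_vec M orbit u"
      using subgroup.mem_carrier[OF sub p(1)] unfolding carrier_point_module[OF S_top] by blast
    have uU: "u \<in> U" using p(1) u unfolding U_def by simp
    obtain x where x: "x \<in> orbit" "u x \<noteq> 0"
      using p(2) unfolding u one_point_module[OF S_top] point_vec_eq_iff[OF S_top] by blast
    have xT: "x \<in> T"
      using delta[OF uU x] x(1) unfolding T_def by simp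
    have "orbit \<subseteq> T"
    proof
      fix y assume y: "y \<in> orbit"
      obtain g where g: "g \<in> gimel" "y = g \<otimes>\<^bsub>V\<^esub> x"
        using orbit_transitive[OF gimel assms(2)] x(1) y unfolding assms(11) by blast
      have "T \<subseteq> carrier V" using S unfolding T_def by blast
      moreover have "g \<in> submonoid_generated V \<Xi>" using g(1) monoid_eq_group by simp
      ultimately show "y \<in> T"
        unfolding g(2) by (intro submonoid_generated_invariant[OF \<Xi> _ _ _ xT] T)
    qed
    then have delta_all: "(\<lambda>z. if z = x then a else 0) \<in> U" if "x \<in> orbit" for x a
      using that unfolding T_def by blast
    have "w \<in> U" if "finite {x \<in> orbit. w x \<noteq> 0}" for w
      by (rule finite_support_in_span[of U orbit]) (fact add cong zero delta_all that)+
    then have "carrier (point_module M orbit) \<subseteq> N"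
      unfolding carrier_point_module[OF S_top] U_def by blast
    then show ?thesis using subgroup.subset[OF sub] by blast
  qed
  moreover have "submodule_of \<A> (point_module M orbit) (point_act V M orbit)
      (carrier (point_module M orbit))"
    unfolding submodule_of_def
    using group.subgroup_self[OF group_point_module[OF S_top]] point_act_closed[OF S assms(13)]
    by blast
  moreover have "carrier (point_module M orbit) \<noteq> {\<one>\<^bsub>point_module M orbit\<^esub>}"
  proof -
    let ?u = "\<lambda>x. if x = v then 1 else 0 :: complex"
    have "finite {x \<in> orbit. ?u x \<noteq> 0}" by (rule finite_subset[of _ "{v}"]) auto
    then have "point_vec M orbit ?u \<in> carrier (point_module M orbit)"
      unfolding carrier_point_module[OF S_top] by blast
    moreover have "point_vec M orbit ?u \<noteq> \<one>\<^bsub>point_module M orbit\<^esub>"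
      unfolding one_point_module[OF S_top] point_vec_eq_iff[OF S_top] using v_orbit by auto
    ultimately show ?thesis by blast
  qed
  ultimately show ?thesis unfolding irreducible_module_def by blast
qed

end
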